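(* Let $(M,g,J)$ be a para-K\"ahler manifold and let $\varphi\colon(M,g)\to(N,h)$ be an anti-isometry of pseudo-Riemannian manifolds. If $\sigma$ is a harmonic vector field on $(M,g)$ then the push-forward $\varphi_*(J\sigma)$ is a harmonic vector field on $(N,h)$, with the same metric parameters.
   Context: An almost para-Hermitian structure on a pseudo-Riemannian manifold $(M,g)$ is a $(1,1)$-tensor field $J$ that is skew-symmetric ($g(JX,Y)=-g(X,JY)$) and satisfies $J^2=1$; it is para-K\"ahler if in addition $\nabla J=0$ for the Levi-Civita connection $\nabla$. An anti-isometry $\varphi\colon(M,g)\to(N,h)$ is a diffeomorphism with $\varphi^*h=-g$. Push-forward: $(\varphi_*\sigma)(y)=d\varphi(\sigma(\varphi^{-1}(y)))$. Let $\sigma$ be a vector field on a pseudo-Riemannian manifold $(M,g=\langle\cdot,\cdot\rangle)$ with Levi-Civita connection $\nabla$, $F=\frac12\langle\sigma,\sigma\rangle$, $\nabla F=\operatorname{grad}F$, $\Delta F=-\operatorname{div}\nabla F$. For a local orthonormal frame $\{E_i\}$ with $\epsilon_i=\langle E_i,E_i\rangle=\pm1$ put $\langle\nabla\sigma,\nabla\sigma\rangle=\sum_i\epsilon_i\langle\nabla_{E_i}\sigma,\nabla_{E_i}\sigma\rangle$ and $\nabla^*\nabla\sigma=-\sum_i\epsilon_i\nabla^2_{E_i,E_i}\sigma$. Then $\sigma$ is $(p,q)$-harmonic if $\tau_{p,q}(\sigma)=0$ identically on $M$, where $$\tau_{p,q}(\sigma)=(1+2F)\nabla^*\nabla\sigma+2p\nabla_{\nabla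 F}\sigma-\bigl(p\langle\nabla\sigma,\nabla\sigma\rangle-pq\,g(\nabla F,\nabla F)-q(1+2F)\Delta F\bigr)\sigma ;$$ $\sigma$ is a harmonic vector field if it is $(p,q)$-harmonic for some $(p,q)\in\mathbb{R}^2$, and such $(p,q)$ are called metric parameters of $\sigma$. *)

theory Defs
  imports "HOL-Analysis.Analysis" "HOL-Library.Function_Algebras"
begin

text \<open>Pointwise real vector space structure on functions; tangent vectors are functions of charts.\<close>

instantiation "fun" :: (type, scaleR) scaleR
begin

definition scaleR_fun :: "real \<Rightarrow> ('a \<Rightarrow> 'b) \<Rightarrow> 'a \<Rightarrow> 'b"
  where "scaleR_fun r f = (\<lambda>x. r *\<^sub>R f x)"

instance ..

end

instance "fun" :: (type, real_vector) real_vector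
  by standard (auto simp: scaleR_fun_def plus_fun_def algebra_simps)

section \<open>Smooth manifolds\<close>

text \<open>\<open>C\<^sup>k\<close> and \<open>C\<^sup>\<infinity>\<close> maps on an open set, through iterated directional derivatives.\<close>

primrec Ck_on :: "nat \<Rightarrow> 'a::real_normed_vector set \<Rightarrow> ('a \<Rightarrow> 'b::real_normed_vector) \<Rightarrow> bool" where
  "Ck_on 0 S f \<longleftrightarrow> continuous_on S f"
| "Ck_on (Suc k) S f \<longleftrightarrow>
     (\<forall>x\<in>S. f differentiable (at x)) \<and>
     (\<forall>v. Ck_on k S (\<lambda>x. frechet_derivative f (at x) v))"

definition smooth_on :: "'a::real_normed_vector set \<Rightarrow> ('a \<Rightarrow> 'b::real_normed_vector) \<Rightarrow> bool"
  where "smooth_on S f \<longleftrightarrow> (\<forall>k. Ck_on k S f)"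

text \<open>A chart is a pair of its domain and its coordinate map; the values of the latter outside the
  domain are irrelevant. An \<open>n\<close>-dimensional manifold is modelled on \<open>real ^ 'n\<close>, \<open>n = CARD('n)\<close>.\<close>

type_synonym ('a, 'n) chart = "'a set \<times> ('a \<Rightarrow> real ^ 'n)"

abbreviation chart_inv :: "('a, 'n) chart \<Rightarrow> real ^ 'n \<Rightarrow> 'a"
  where "chart_inv c \<equiv> inv_into (fst c) (snd c)"

record ('a, 'n) manifold =
  mtop :: "'a topology"
  atlas :: "('a, 'n) chart set"

abbreviation points :: "('a, 'n) manifold \<Rightarrow> 'a set"
  where "points M \<equiv> topspace (mtop M)"

definition is_chart :: "'a topology \<Rightarrow> ('a, 'n::finite) chart \<Rightarrow> bool" where
  "is_chart T c \<longleftrightarrow>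
     openin T (fst c) \<and> open (snd c ` fst c) \<and>
     homeomorphic_map (subtopology T (fst c)) (top_of_set (snd c ` fst c)) (snd c)"

definition compatible :: "('a, 'n::finite) chart \<Rightarrow> ('a, 'n) chart \<Rightarrow> bool" where
  "compatible c d \<longleftrightarrow>
     smooth_on (snd c ` (fst c \<inter> fst d)) (snd d \<circ> chart_inv c) \<and>
     smooth_on (snd d ` (fst c \<inter> fst d)) (snd c \<circ> chart_inv d)"

text \<open>A smooth structure is a maximal atlas.\<close>

definition smooth_manifold :: "('a, 'n::finite) manifold \<Rightarrow> bool" where
  "smooth_manifold M \<longleftrightarrow>
     Hausdorff_space (mtop M) \<and> second_countable (mtop M) \<and>
     (\<forall>c\<in>atlas M. is_chart (mtop M) c) \<and>
     \<Union> (fst ` atlas M) = points M \<and>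
     (\<forall>c\<in>atlas M. \<forall>d\<in>atlas M. compatible c d) \<and>
     (\<forall>c. is_chart (mtop M) c \<and> (\<forall>d\<in>atlas M. compatible c d) \<longrightarrow> c \<in> atlas M)"

definition charts_at :: "('a, 'n) manifold \<Rightarrow> 'a \<Rightarrow> ('a, 'n) chart set"
  where "charts_at M x = {c \<in> atlas M. x \<in> fst c}"

definition smooth_fun_on :: "('a, 'n::finite) manifold \<Rightarrow> 'a set \<Rightarrow> ('a \<Rightarrow> real) \<Rightarrow> bool" where
  "smooth_fun_on M U f \<longleftrightarrow> (\<forall>c\<in>atlas M. smooth_on (snd c ` (U \<inter> fst c)) (f \<circ> chart_inv c))"

definition smooth_map ::
    "('a, 'm::finite) manifold \<Rightarrow> ('b, 'n::finite) manifold \<Rightarrow> ('a \<Rightarrow> 'b) \<Rightarrow> bool" where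
  "smooth_map M N \<phi> \<longleftrightarrow>
     continuous_map (mtop M) (mtop N) \<phi> \<and>
     (\<forall>c\<in>atlas M. \<forall>d\<in>atlas N.
        smooth_on (snd c ` (fst c \<inter> \<phi> -` fst d)) (snd d \<circ> \<phi> \<circ> chart_inv c))"

definition diffeomorphism ::
    "('a, 'n::finite) manifold \<Rightarrow> ('b, 'n) manifold \<Rightarrow> ('a \<Rightarrow> 'b) \<Rightarrow> bool" where
  "diffeomorphism M N \<phi> \<longleftrightarrow>
     bij_betw \<phi> (points M) (points N) \<and>
     smooth_map M N \<phi> \<and> smooth_map N M (inv_into (points M) \<phi>)"

section \<open>Tangent vectors and vector fields\<close>

text \<open>A tangent vector at \<open>x\<close> is the family of its components in the charts around \<open>x\<close>, related by the
  Jacobians of the coordinate changes. The family is set to \<open>0\<close> on all other charts.\<close>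

type_synonym ('a, 'n) tvec = "('a, 'n) chart \<Rightarrow> real ^ 'n"

definition tangent_space :: "('a, 'n::finite) manifold \<Rightarrow> 'a \<Rightarrow> ('a, 'n) tvec set" where
  "tangent_space M x = {v.
     (\<forall>c. c \<notin> charts_at M x \<longrightarrow> v c = 0) \<and>
     (\<forall>c\<in>charts_at M x. \<forall>d\<in>charts_at M x.
        v d = frechet_derivative (snd d \<circ> chart_inv c) (at (snd c x)) (v c))}"

text \<open>The derivative of a function along \<open>v\<close> and the differential of a map may be computed in any
  chart around \<open>x\<close>, by the chain rule.\<close>

definition dir_deriv ::
    "('a, 'n::finite) manifold \<Rightarrow> 'a \<Rightarrow> ('a, 'n) tvec \<Rightarrow> ('a \<Rightarrow> real) \<Rightarrow> real" where
  "dir_deriv M x v f =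
     (let c = (SOME c. c \<in> charts_at M x)
      in frechet_derivative (f \<circ> chart_inv c) (at (snd c x)) (v c))"

definition differential ::
    "('a, 'm::finite) manifold \<Rightarrow> ('b, 'n::finite) manifold \<Rightarrow> ('a \<Rightarrow> 'b) \<Rightarrow>
     'a \<Rightarrow> ('a, 'm) tvec \<Rightarrow> ('b, 'n) tvec" where
  "differential M N \<phi> x v = (\<lambda>d.
     if d \<in> charts_at N (\<phi> x)
     then let c = (SOME c. c \<in> charts_at M x)
          in frechet_derivative (snd d \<circ> \<phi> \<circ> chart_inv c) (at (snd c x)) (v c)
     else 0)"

text \<open>Local vector fields are total functions whose values outside the open set \<open>U\<close> are irrelevant.\<close>

definition vector_field_on ::
    "('a, 'n::finite) manifold \<Rightarrow> 'a set \<Rightarrow> ('a \<Rightarrow> ('a, 'n) tvec) \<Rightarrow> bool" where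
  "vector_field_on M U X \<longleftrightarrow>
     (\<forall>x\<in>U. X x \<in> tangent_space M x) \<and>
     (\<forall>c\<in>atlas M. smooth_on (snd c ` (U \<inter> fst c)) (\<lambda>u. X (chart_inv c u) c))"

text \<open>In each chart, \<open>[X,Y] = DY(X) - DX(Y)\<close>.\<close>

definition lie_bracket ::
    "('a, 'n::finite) manifold \<Rightarrow> ('a \<Rightarrow> ('a, 'n) tvec) \<Rightarrow> ('a \<Rightarrow> ('a, 'n) tvec) \<Rightarrow> 'a \<Rightarrow> ('a, 'n) tvec"
  where
  "lie_bracket M X Y x = (\<lambda>c.
     if c \<in> charts_at M x
     then frechet_derivative (\<lambda>u. Y (chart_inv c u) c) (at (snd c x)) (X x c)
        - frechet_derivative (\<lambda>u. X (chart_inv c u) c) (at (snd c x)) (Y x c)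
     else 0)"

definition push_forward ::
    "('a, 'm::finite) manifold \<Rightarrow> ('b, 'n::finite) manifold \<Rightarrow> ('a \<Rightarrow> 'b) \<Rightarrow>
     ('a \<Rightarrow> ('a, 'm) tvec) \<Rightarrow> 'b \<Rightarrow> ('b, 'n) tvec" where
  "push_forward M N \<phi> \<sigma> y =
     (let x = inv_into (points M) \<phi> y in differential M N \<phi> x (\<sigma> x))"

definition lin_on :: "'v::real_vector set \<Rightarrow> ('v \<Rightarrow> 'w::real_vector) \<Rightarrow> bool" where
  "lin_on V f \<longleftrightarrow> (\<forall>v\<in>V. \<forall>w\<in>V. \<forall>a b. f (a *\<^sub>R v + b *\<^sub>R w) = a *\<^sub>R f v + b *\<^sub>R f w)"

section \<open>Pseudo-Riemannian metrics and the Levi-Civita connection\<close>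

type_synonym ('a, 'n) metric = "'a \<Rightarrow> ('a, 'n) tvec \<Rightarrow> ('a, 'n) tvec \<Rightarrow> real"

definition pseudo_riemannian :: "('a, 'n::finite) manifold \<Rightarrow> ('a, 'n) metric \<Rightarrow> bool" where
  "pseudo_riemannian M g \<longleftrightarrow>
     smooth_manifold M \<and>
     (\<forall>x\<in>points M.
        (\<forall>v\<in>tangent_space M x. lin_on (tangent_space M x) (g x v)) \<and>
        (\<forall>v\<in>tangent_space M x. \<forall>w\<in>tangent_space M x. g x v w = g x w v) \<and>
        (\<forall>v\<in>tangent_space M x. (\<forall>w\<in>tangent_space M x. g x v w = 0) \<longrightarrow> v = 0)) \<and>
     (\<forall>U X Y. openin (mtop M) U \<and> vector_field_on M U X \<and> vector_field_on M U Y \<longrightarrow>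
        smooth_fun_on M U (\<lambda>x. g x (X x) (Y x)))"

text \<open>\<open>D x v Y\<close> is the covariant derivative at \<open>x\<close> in direction \<open>v\<close> of a vector field \<open>Y\<close> which is
  smooth near \<open>x\<close>. Being a function of \<open>v\<close>, it is tensorial in the direction; locality in \<open>Y\<close> is an
  axiom because \<open>Y\<close> is a total function.\<close>

type_synonym ('a, 'n) connection =
  "'a \<Rightarrow> ('a, 'n) tvec \<Rightarrow> ('a \<Rightarrow> ('a, 'n) tvec) \<Rightarrow> ('a, 'n) tvec"

definition linear_connection :: "('a, 'n::finite) manifold \<Rightarrow> ('a, 'n) connection \<Rightarrow> bool" where
  "linear_connection M D \<longleftrightarrow>
     (\<forall>U. openin (mtop M) U \<longrightarrow>
       (\<forall>X Y. vector_field_on M U X \<and> vector_field_on M U Y \<longrightarrow>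
          vector_field_on M U (\<lambda>x. D x (X x) Y)) \<and>
       (\<forall>Y. vector_field_on M U Y \<longrightarrow> (\<forall>x\<in>U. lin_on (tangent_space M x) (\<lambda>v. D x v Y))) \<and>
       (\<forall>Y Z. vector_field_on M U Y \<and> vector_field_on M U Z \<longrightarrow>
          (\<forall>x\<in>U. \<forall>v\<in>tangent_space M x. D x v (\<lambda>y. Y y + Z y) = D x v Y + D x v Z)) \<and>
       (\<forall>f Y. smooth_fun_on M U f \<and> vector_field_on M U Y \<longrightarrow>
          (\<forall>x\<in>U. \<forall>v\<in>tangent_space M x.
             D x v (\<lambda>y. f y *\<^sub>R Y y) = dir_deriv M x v f *\<^sub>R Y x + f x *\<^sub>R D x v Y)) \<and>
       (\<forall>Y Z. vector_field_on M U Y \<and> (\<forall>x\<in>U. Y x = Z x) \<longrightarrow>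
          (\<forall>x\<in>U. \<forall>v\<in>tangent_space M x. D x v Y = D x v Z)))"

definition torsion_free :: "('a, 'n::finite) manifold \<Rightarrow> ('a, 'n) connection \<Rightarrow> bool" where
  "torsion_free M D \<longleftrightarrow>
     (\<forall>U X Y. openin (mtop M) U \<and> vector_field_on M U X \<and> vector_field_on M U Y \<longrightarrow>
        (\<forall>x\<in>U. D x (X x) Y - D x (Y x) X = lie_bracket M X Y x))"

definition metric_connection ::
    "('a, 'n::finite) manifold \<Rightarrow> ('a, 'n) metric \<Rightarrow> ('a, 'n) connection \<Rightarrow> bool" where
  "metric_connection M g D \<longleftrightarrow>
     (\<forall>U Y Z. openin (mtop M) U \<and> vector_field_on M U Y \<and> vector_field_on M U Z \<longrightarrow>
        (\<forall>x\<in>U. \<forall>v\<in>tangent_space M x.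
           dir_deriv M x v (\<lambda>y. g y (Y y) (Z y)) = g x (D x v Y) (Z x) + g x (Y x) (D x v Z)))"

definition levi_civita ::
    "('a, 'n::finite) manifold \<Rightarrow> ('a, 'n) metric \<Rightarrow> ('a, 'n) connection \<Rightarrow> bool" where
  "levi_civita M g D \<longleftrightarrow>
     linear_connection M D \<and> torsion_free M D \<and> metric_connection M g D"

section \<open>Para-Kaehler structures and anti-isometries\<close>

definition tensor_field_11 ::
    "('a, 'n::finite) manifold \<Rightarrow> ('a \<Rightarrow> ('a, 'n) tvec \<Rightarrow> ('a, 'n) tvec) \<Rightarrow> bool" where
  "tensor_field_11 M J \<longleftrightarrow>
     (\<forall>x\<in>points M. J x ` tangent_space M x \<subseteq> tangent_space M x \<and> lin_on (tangent_space M x) (J x)) \<and>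
     (\<forall>U X. openin (mtop M) U \<and> vector_field_on M U X \<longrightarrow> vector_field_on M U (\<lambda>x. J x (X x)))"

definition almost_para_hermitian ::
    "('a, 'n::finite) manifold \<Rightarrow> ('a, 'n) metric \<Rightarrow>
     ('a \<Rightarrow> ('a, 'n) tvec \<Rightarrow> ('a, 'n) tvec) \<Rightarrow> bool" where
  "almost_para_hermitian M g J \<longleftrightarrow>
     pseudo_riemannian M g \<and> tensor_field_11 M J \<and>
     (\<forall>x\<in>points M.
        (\<forall>v\<in>tangent_space M x. \<forall>w\<in>tangent_space M x. g x (J x v) w = - g x v (J x w)) \<and>
        (\<forall>v\<in>tangent_space M x. J x (J x v) = v))"

text \<open>The last condition is \<open>(D\<^sub>v J) Y = D\<^sub>v (J Y) - J (D\<^sub>v Y) = 0\<close>; \<open>D\<close> is the Levi-Civita connection.\<close>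

definition para_kaehler ::
    "('a, 'n::finite) manifold \<Rightarrow> ('a, 'n) metric \<Rightarrow> ('a, 'n) connection \<Rightarrow>
     ('a \<Rightarrow> ('a, 'n) tvec \<Rightarrow> ('a, 'n) tvec) \<Rightarrow> bool" where
  "para_kaehler M g D J \<longleftrightarrow>
     almost_para_hermitian M g J \<and> levi_civita M g D \<and>
     (\<forall>U Y. openin (mtop M) U \<and> vector_field_on M U Y \<longrightarrow>
        (\<forall>x\<in>U. \<forall>v\<in>tangent_space M x. D x v (\<lambda>y. J y (Y y)) - J x (D x v Y) = 0))"

definition anti_isometry ::
    "('a, 'n::finite) manifold \<Rightarrow> ('a, 'n) metric \<Rightarrow> ('b, 'n) manifold \<Rightarrow> ('b, 'n) metric \<Rightarrow>
     ('a \<Rightarrow> 'b) \<Rightarrow> bool" where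
  "anti_isometry M g N h \<phi> \<longleftrightarrow>
     diffeomorphism M N \<phi> \<and>
     (\<forall>x\<in>points M. \<forall>v\<in>tangent_space M x. \<forall>w\<in>tangent_space M x.
        h (\<phi> x) (differential M N \<phi> x v) (differential M N \<phi> x w) = - g x v w)"

section \<open>Harmonic vector fields\<close>

definition local_orthonormal_frame ::
    "('a, 'n::finite) manifold \<Rightarrow> ('a, 'n) metric \<Rightarrow> 'a set \<Rightarrow> ('n \<Rightarrow> 'a \<Rightarrow> ('a, 'n) tvec) \<Rightarrow> bool" where
  "local_orthonormal_frame M g U E \<longleftrightarrow>
     openin (mtop M) U \<and> (\<forall>i. vector_field_on M U (E i)) \<and>
     (\<forall>x\<in>U. \<forall>i j. if i = j then g x (E i x) (E j x) \<in> {1, -1} else g x (E i x) (E j x) = 0)"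

definition grad :: "('a, 'n::finite) manifold \<Rightarrow> ('a, 'n) metric \<Rightarrow> ('a \<Rightarrow> real) \<Rightarrow> 'a \<Rightarrow> ('a, 'n) tvec"
  where "grad M g f x =
    (THE v. v \<in> tangent_space M x \<and> (\<forall>w\<in>tangent_space M x. g x v w = dir_deriv M x w f))"

text \<open>In the remaining operators \<open>E\<close> is a local orthonormal frame around \<open>x\<close>, on which the values do
  not depend; \<open>g x (E i x) (E i x)\<close> is the sign \<open>\<epsilon>\<^sub>i\<close>.\<close>

definition divergence ::
    "('a, 'n::finite) metric \<Rightarrow> ('a, 'n) connection \<Rightarrow> ('n \<Rightarrow> 'a \<Rightarrow> ('a, 'n) tvec) \<Rightarrow>
     ('a \<Rightarrow> ('a, 'n) tvec) \<Rightarrow> 'a \<Rightarrow> real" where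
  "divergence g D E X x = (\<Sum>i\<in>UNIV. g x (E i x) (E i x) * g x (D x (E i x) X) (E i x))"

definition laplacian ::
    "('a, 'n::finite) manifold \<Rightarrow> ('a, 'n) metric \<Rightarrow> ('a, 'n) connection \<Rightarrow>
     ('n \<Rightarrow> 'a \<Rightarrow> ('a, 'n) tvec) \<Rightarrow> ('a \<Rightarrow> real) \<Rightarrow> 'a \<Rightarrow> real" where
  "laplacian M g D E f x = - divergence g D E (grad M g f) x"

definition nabla_norm ::
    "('a, 'n::finite) metric \<Rightarrow> ('a, 'n) connection \<Rightarrow> ('n \<Rightarrow> 'a \<Rightarrow> ('a, 'n) tvec) \<Rightarrow>
     ('a \<Rightarrow> ('a, 'n) tvec) \<Rightarrow> 'a \<Rightarrow> real" where
  "nabla_norm g D E \<sigma> x =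
     (\<Sum>i\<in>UNIV. g x (E i x) (E i x) * g x (D x (E i x) \<sigma>) (D x (E i x) \<sigma>))"

definition second_cov_deriv ::
    "('a, 'n::finite) connection \<Rightarrow> ('a \<Rightarrow> ('a, 'n) tvec) \<Rightarrow> ('a \<Rightarrow> ('a, 'n) tvec) \<Rightarrow>
     ('a \<Rightarrow> ('a, 'n) tvec) \<Rightarrow> 'a \<Rightarrow> ('a, 'n) tvec" where
  "second_cov_deriv D X Y \<sigma> x = D x (X x) (\<lambda>y. D y (Y y) \<sigma>) - D x (D x (X x) Y) \<sigma>"

definition rough_laplacian ::
    "('a, 'n::finite) metric \<Rightarrow> ('a, 'n) connection \<Rightarrow> ('n \<Rightarrow> 'a \<Rightarrow> ('a, 'n) tvec) \<Rightarrow>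
     ('a \<Rightarrow> ('a, 'n) tvec) \<Rightarrow> 'a \<Rightarrow> ('a, 'n) tvec" where
  "rough_laplacian g D E \<sigma> x =
     - (\<Sum>i\<in>UNIV. g x (E i x) (E i x) *\<^sub>R second_cov_deriv D (E i) (E i) \<sigma> x)"

definition tension ::
    "('a, 'n::finite) manifold \<Rightarrow> ('a, 'n) metric \<Rightarrow> ('a, 'n) connection \<Rightarrow>
     ('n \<Rightarrow> 'a \<Rightarrow> ('a, 'n) tvec) \<Rightarrow> real \<Rightarrow> real \<Rightarrow> ('a \<Rightarrow> ('a, 'n) tvec) \<Rightarrow> 'a \<Rightarrow> ('a, 'n) tvec" where
  "tension M g D E p q \<sigma> x =
     (let F = (\<lambda>y. g y (\<sigma> y) (\<sigma> y) / 2); dF = grad M g F in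
      (1 + 2 * F x) *\<^sub>R rough_laplacian g D E \<sigma> x
      + (2 * p) *\<^sub>R D x (dF x) \<sigma>
      - (p * nabla_norm g D E \<sigma> x - p * q * g x (dF x) (dF x)
         - q * (1 + 2 * F x) * laplacian M g D E F x) *\<^sub>R \<sigma> x)"

text \<open>\<open>D\<close> is the Levi-Civita connection of \<open>g\<close>. Every point has a neighbourhood with a local
  orthonormal frame, and vanishing of the tension at the point does not depend on the frame.\<close>

definition pq_harmonic ::
    "('a, 'n::finite) manifold \<Rightarrow> ('a, 'n) metric \<Rightarrow> ('a, 'n) connection \<Rightarrow> real \<Rightarrow> real \<Rightarrow>
     ('a \<Rightarrow> ('a, 'n) tvec) \<Rightarrow> bool" where
  "pq_harmonic M g D p q \<sigma> \<longleftrightarrow>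
     vector_field_on M (points M) \<sigma> \<and>
     (\<forall>x\<in>points M. \<exists>U E. x \<in> U \<and> local_orthonormal_frame M g U E \<and> tension M g D E p q \<sigma> x = 0)"

definition metric_parameters ::
    "('a, 'n::finite) manifold \<Rightarrow> ('a, 'n) metric \<Rightarrow> ('a, 'n) connection \<Rightarrow>
     ('a \<Rightarrow> ('a, 'n) tvec) \<Rightarrow> (real \<times> real) set" where
  "metric_parameters M g D \<sigma> = {(p, q). pq_harmonic M g D p q \<sigma>}"

definition harmonic_vector_field ::
    "('a, 'n::finite) manifold \<Rightarrow> ('a, 'n) metric \<Rightarrow> ('a, 'n) connection \<Rightarrow>
     ('a \<Rightarrow> ('a, 'n) tvec) \<Rightarrow> bool" where
  "harmonic_vector_field M g D \<sigma> \<longleftrightarrow> (\<exists>p q. pq_harmonic M g D p q \<sigma>)"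

end

theory Submission
  imports Defs
begin

text \<open>Write \<open>\<sigma>' = \<phi>\<^sub>*(J \<sigma>)\<close>. Both \<open>J\<close> and \<open>d\<phi>\<close> reverse the sign of the metric, so \<open>d\<phi> \<circ> J\<close> is a linear
  isometry of tangent spaces, and \<open>\<sigma>'\<close> has the same function \<open>F\<close> as \<open>\<sigma>\<close>. The metrics \<open>g\<close> and \<open>- g\<close> have the
  same Levi-Civita connection, so \<open>d\<phi>\<close> carries the connection of \<open>g\<close> to that of \<open>h\<close>
  (\<open>levi_civita_natural\<close>), and because \<open>J\<close> is parallel, \<open>d\<phi> \<circ> J\<close> maps the covariant derivatives of \<open>\<sigma>\<close> to
  those of \<open>\<sigma>'\<close>. The only difference left is the metric used for contractions. The rough Laplacian, the
  norm of \<open>\<nabla>\<sigma>\<close>, the gradient of \<open>F\<close>, its squared length and its Laplacian all change their sign, and every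
  term of the tension contains exactly one of them. Therefore the tension of \<open>\<sigma>'\<close> is the image of minus
  the tension of \<open>\<sigma>\<close> under \<open>d\<phi> \<circ> J\<close> (\<open>tension_related\<close>), which is injective; the two tensions vanish
  for the same parameters \<open>(p, q)\<close>.

  The connections are given axiomatically, so their correspondence is an instance of the uniqueness of
  the Levi-Civita connection. Its proof extends tangent vectors to vector fields; here the local
  orthonormal frames that accompany harmonicity supply the extensions (\<open>tangent_vector_extends\<close>), and
  they also make gradients smooth. Objects are transported along \<open>\<phi>\<close> by comparing a chart of \<open>N\<close> with
  its pullback, which belongs to the maximal atlas of \<open>M\<close> (\<open>pullback_chart_in_atlas\<close>). In these two
  charts corresponding fields have equal components.\<close>

section \<open>Smooth maps\<close>

lemma frechet_derivative_cong_open: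
  assumes "open S" "x \<in> S" "\<And>y. y \<in> S \<Longrightarrow> f y = g y"
  shows "frechet_derivative f (at x) = frechet_derivative g (at x)"
proof -
  have "(f has_derivative F) (at x) \<longleftrightarrow> (g has_derivative F) (at x)" for F
    using has_derivative_transform_within_open[of f F x UNIV S g]
      has_derivative_transform_within_open[of g F x UNIV S f] assms by auto
  then show ?thesis
    by (simp add: frechet_derivative_def)
qed

lemma has_derivative_imp_frechet_derivative:
  assumes "(f has_derivative f') (at x)"
  shows "f differentiable (at x) \<and> frechet_derivative f (at x) = f'"
  using assms frechet_derivative_at[OF assms] unfolding differentiable_def by blast

lemma differentiable_cong_open:
  assumes "open S" "x \<in> S" "\<And>y. y \<in> S \<Longrightarrow> f y = g y" "f differentiable (at x)"
  shows "g differentiable (at x)"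
  using has_derivative_transform_within_open[of f _ x UNIV S g] assms
  unfolding differentiable_def by metis

lemma Ck_on_cong:
  assumes "open S" "\<And>x. x \<in> S \<Longrightarrow> f x = g x" "Ck_on k S f"
  shows "Ck_on k S g"
  using assms(2,3)
proof (induction k arbitrary: f g)
  case 0
  then show ?case using continuous_on_cong[of S S f g] by simp
next
  case (Suc k)
  have "g differentiable (at x)" if "x \<in> S" for x
    using differentiable_cong_open[OF assms(1) that, of f g] Suc.prems that by auto
  moreover have "Ck_on k S (\<lambda>x. frechet_derivative g (at x) v)" for v
  proof (rule Suc.IH)
    show "Ck_on k S (\<lambda>x. frechet_derivative f (at x) v)"
      using Suc.prems(2) by simp
    show "frechet_derivative f (at x) v = frechet_derivative g (at x) v" if "x \<in> S" for x
      using frechet_derivative_cong_open[OF assms(1) that, of f g] Suc.prems(1) by simp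
  qed
  ultimately show ?case by simp
qed

lemma smooth_on_cong:
  assumes "open S" "\<And>x. x \<in> S \<Longrightarrow> f x = g x" "smooth_on S f"
  shows "smooth_on S g"
  using assms Ck_on_cong unfolding smooth_on_def by blast

lemma Ck_on_subset: "Ck_on k S f \<Longrightarrow> T \<subseteq> S \<Longrightarrow> Ck_on k T f"
  by (induction k arbitrary: f) (auto intro: continuous_on_subset)

lemma smooth_on_subset: "smooth_on S f \<Longrightarrow> T \<subseteq> S \<Longrightarrow> smooth_on T f"
  using Ck_on_subset unfolding smooth_on_def by blast

lemma Ck_on_SucD: "Ck_on (Suc k) S f \<Longrightarrow> Ck_on k S f"
proof (induction k arbitrary: f)
  case 0
  then show ?case
    by (auto intro!: continuous_at_imp_continuous_on differentiable_imp_continuous_within)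
next
  case (Suc k)
  have "Ck_on k S (\<lambda>x. frechet_derivative f (at x) v)" for v
    using Suc.IH[of "\<lambda>x. frechet_derivative f (at x) v"] Suc.prems by simp
  then show ?case using Suc.prems by simp
qed

lemma smooth_on_differentiable: "smooth_on S f \<Longrightarrow> x \<in> S \<Longrightarrow> f differentiable (at x)"
  unfolding smooth_on_def by (drule spec[of _ "Suc 0"]) simp

lemma smooth_on_frechet_derivative:
  assumes "smooth_on S f"
  shows "smooth_on S (\<lambda>x. frechet_derivative f (at x) v)"
  unfolding smooth_on_def
proof
  fix k
  have "Ck_on (Suc k) S f"
    using assms by (simp only: smooth_on_def)
  then show "Ck_on k S (\<lambda>x. frechet_derivative f (at x) v)"
    by simp
qed

lemma Ck_on_const: "Ck_on k S (\<lambda>x. c)"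
  by (induction k arbitrary: c) (simp_all add: frechet_derivative_const)

lemma smooth_on_const: "smooth_on S (\<lambda>x. c)"
  by (simp add: smooth_on_def Ck_on_const)

lemma Ck_on_add:
  assumes "open S" "Ck_on k S f" "Ck_on k S g"
  shows "Ck_on k S (\<lambda>x. f x + g x)"
  using assms(2,3)
proof (induction k arbitrary: f g)
  case 0
  then show ?case by (simp add: continuous_on_add)
next
  case (Suc k)
  have diff: "(\<lambda>x. f x + g x) differentiable (at x)"
    and deriv: "frechet_derivative (\<lambda>x. f x + g x) (at x) =
      (\<lambda>v. frechet_derivative f (at x) v + frechet_derivative g (at x) v)"
    if "x \<in> S" for x
  proof -
    have "((\<lambda>x. f x + g x) has_derivative
      (\<lambda>v. frechet_derivative f (at x) v + frechet_derivative g (at x) v)) (at x)"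
      using Suc.prems that
      by (intro has_derivative_add) (auto simp flip: frechet_derivative_works)
    then show "(\<lambda>x. f x + g x) differentiable (at x)"
      and "frechet_derivative (\<lambda>x. f x + g x) (at x) =
      (\<lambda>v. frechet_derivative f (at x) v + frechet_derivative g (at x) v)"
      by (auto dest: has_derivative_imp_frechet_derivative)
  qed
  have "Ck_on k S (\<lambda>x. frechet_derivative (\<lambda>x. f x + g x) (at x) v)" for v
    by (rule Ck_on_cong[OF assms(1) _ Suc.IH[of "\<lambda>x. frechet_derivative f (at x) v"
          "\<lambda>x. frechet_derivative g (at x) v"]])
      (use Suc.prems deriv in auto)
  then show ?case unfolding Ck_on.simps using diff by blast
qed

lemma smooth_on_add:
  "open S \<Longrightarrow> smooth_on S f \<Longrightarrow> smooth_on S g \<Longrightarrow> smooth_on S (\<lambda>x. f x + g x)"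
  unfolding smooth_on_def by (intro allI, rule Ck_on_add) simp_all

lemma smooth_on_sum:
  assumes "open S" "\<And>i. i \<in> I \<Longrightarrow> smooth_on S (f i)"
  shows "smooth_on S (\<lambda>x. \<Sum>i\<in>I. f i x)"
  using assms(2)
  by (induction I rule: infinite_finite_induct)
    (simp_all add: smooth_on_const smooth_on_add[OF assms(1)])

lemma Ck_on_bounded_linear:
  assumes "open S" "bounded_linear L" "Ck_on k S f"
  shows "Ck_on k S (\<lambda>x. L (f x))"
  using assms(3)
proof (induction k arbitrary: f)
  case 0
  then show ?case
    using bounded_linear.continuous_on[OF assms(2)] by simp
next
  case (Suc k)
  have diff: "(\<lambda>x. L (f x)) differentiable (at x)"
    and deriv: "frechet_derivative (\<lambda>x. L (f x)) (at x) = (\<lambda>v. L (frechet_derivative f (at x) v))"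
    if "x \<in> S" for x
  proof -
    have "((\<lambda>x. L (f x)) has_derivative (\<lambda>v. L (frechet_derivative f (at x) v))) (at x)"
      using Suc.prems that
      by (intro bounded_linear.has_derivative[OF assms(2), of f]) (simp flip: frechet_derivative_works)
    then show "(\<lambda>x. L (f x)) differentiable (at x)"
      and "frechet_derivative (\<lambda>x. L (f x)) (at x) = (\<lambda>v. L (frechet_derivative f (at x) v))"
      by (auto dest: has_derivative_imp_frechet_derivative)
  qed
  have "Ck_on k S (\<lambda>x. frechet_derivative (\<lambda>x. L (f x)) (at x) v)" for v
    by (rule Ck_on_cong[OF assms(1) _ Suc.IH[of "\<lambda>x. frechet_derivative f (at x) v"]])
      (use Suc.prems in \<open>simp_all add: deriv\<close>)
  then show ?case unfolding Ck_on.simps using diff by blast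
qed

lemma smooth_on_bounded_linear:
  "open S \<Longrightarrow> bounded_linear L \<Longrightarrow> smooth_on S f \<Longrightarrow> smooth_on S (\<lambda>x. L (f x))"
  unfolding smooth_on_def by (intro allI, rule Ck_on_bounded_linear) simp_all

lemma Ck_on_scaleR:
  fixes f :: "'a::real_normed_vector \<Rightarrow> real" and g :: "'a \<Rightarrow> 'b::real_normed_vector"
  assumes "open S" "Ck_on k S f" "Ck_on k S g"
  shows "Ck_on k S (\<lambda>x. f x *\<^sub>R g x)"
  using assms(2,3)
proof (induction k arbitrary: f g)
  case 0
  then show ?case by (simp add: continuous_on_scaleR)
next
  case (Suc k)
  have diff: "(\<lambda>x. f x *\<^sub>R g x) differentiable (at x)"
    and deriv: "frechet_derivative (\<lambda>x. f x *\<^sub>R g x) (at x) =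
      (\<lambda>v. f x *\<^sub>R frechet_derivative g (at x) v + frechet_derivative f (at x) v *\<^sub>R g x)"
    if "x \<in> S" for x
  proof -
    have "((\<lambda>x. f x *\<^sub>R g x) has_derivative
      (\<lambda>v. f x *\<^sub>R frechet_derivative g (at x) v + frechet_derivative f (at x) v *\<^sub>R g x)) (at x)"
      using Suc.prems that
      by (intro has_derivative_scaleR) (auto simp flip: frechet_derivative_works)
    then show "(\<lambda>x. f x *\<^sub>R g x) differentiable (at x)"
      and "frechet_derivative (\<lambda>x. f x *\<^sub>R g x) (at x) =
      (\<lambda>v. f x *\<^sub>R frechet_derivative g (at x) v + frechet_derivative f (at x) v *\<^sub>R g x)"
      by (auto dest: has_derivative_imp_frechet_derivative)
  qed
  have "Ck_on k S (\<lambda>x. frechet_derivative (\<lambda>x. f x *\<^sub>R g x) (at x) v)" for v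
  proof (rule Ck_on_cong[OF assms(1) _ Ck_on_add[OF assms(1)]])
    show "Ck_on k S (\<lambda>x. f x *\<^sub>R frechet_derivative g (at x) v)"
      "Ck_on k S (\<lambda>x. frechet_derivative f (at x) v *\<^sub>R g x)"
      using Suc.prems Ck_on_SucD by (auto intro!: Suc.IH)
  qed (simp add: deriv)
  then show ?case unfolding Ck_on.simps using diff by blast
qed

lemma smooth_on_scaleR:
  fixes f :: "'a::real_normed_vector \<Rightarrow> real" and g :: "'a \<Rightarrow> 'b::real_normed_vector"
  shows "open S \<Longrightarrow> smooth_on S f \<Longrightarrow> smooth_on S g \<Longrightarrow> smooth_on S (\<lambda>x. f x *\<^sub>R g x)"
  unfolding smooth_on_def by (intro allI, rule Ck_on_scaleR) simp_all

text \<open>The direction varies with the point, so the derivative is expanded in the basis into directional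
  derivatives along constant vectors, which are smooth by definition.\<close>

lemma smooth_on_derivative_along:
  fixes f :: "'a::euclidean_space \<Rightarrow> 'b::real_normed_vector"
  assumes "open S" "smooth_on S f" "smooth_on S w"
  shows "smooth_on S (\<lambda>x. frechet_derivative f (at x) (w x))"
proof (rule smooth_on_cong[OF assms(1)])
  show "smooth_on S (\<lambda>x. \<Sum>b\<in>Basis. (w x \<bullet> b) *\<^sub>R frechet_derivative f (at x) b)"
    using assms smooth_on_bounded_linear[OF assms(1) bounded_linear_inner_left assms(3)]
    by (simp add: smooth_on_sum smooth_on_scaleR smooth_on_frechet_derivative)
  fix x assume "x \<in> S"
  then have lin: "linear (frechet_derivative f (at x))"
    using assms(2) smooth_on_differentiable linear_frechet_derivative by blast
  have "(\<Sum>b\<in>Basis. (w x \<bullet> b) *\<^sub>R frechet_derivative f (at x) b)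
      = frechet_derivative f (at x) (\<Sum>b\<in>Basis. (w x \<bullet> b) *\<^sub>R b)"
    by (simp only: linear_sum[OF lin] linear_cmul[OF lin])
  then show "(\<Sum>b\<in>Basis. (w x \<bullet> b) *\<^sub>R frechet_derivative f (at x) b) = frechet_derivative f (at x) (w x)"
    by (simp only: euclidean_representation)
qed

section \<open>Charts, tangent spaces and vector fields\<close>

lemma chart_openin: "smooth_manifold M \<Longrightarrow> c \<in> atlas M \<Longrightarrow> openin (mtop M) (fst c)"
  by (simp add: smooth_manifold_def is_chart_def)

lemma chart_subset_points: "smooth_manifold M \<Longrightarrow> c \<in> atlas M \<Longrightarrow> fst c \<subseteq> points M"
  by (simp add: chart_openin openin_subset)

lemma chart_homeomorphic_map:
  "smooth_manifold M \<Longrightarrow> c \<in> atlas M \<Longrightarrow>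
    homeomorphic_map (subtopology (mtop M) (fst c)) (top_of_set (snd c ` fst c)) (snd c)"
  by (simp add: smooth_manifold_def is_chart_def)

lemma chart_inj_on:
  assumes "smooth_manifold M" "c \<in> atlas M"
  shows "inj_on (snd c) (fst c)"
  using homeomorphic_imp_injective_map[OF chart_homeomorphic_map[OF assms]]
    chart_subset_points[OF assms] by (simp add: inf_absorb2)

lemma chart_inv_chart:
  "smooth_manifold M \<Longrightarrow> c \<in> atlas M \<Longrightarrow> x \<in> fst c \<Longrightarrow> chart_inv c (snd c x) = x"
  by (simp add: chart_inj_on)

lemma chart_image_open:
  assumes "smooth_manifold M" "c \<in> atlas M" "openin (mtop M) U"
  shows "open (snd c ` (U \<inter> fst c))"
proof -
  have "openin (subtopology (mtop M) (fst c)) (U \<inter> fst c)"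
    using assms(3) openin_subtopology by blast
  then have "openin (top_of_set (snd c ` fst c)) (snd c ` (U \<inter> fst c))"
    using chart_homeomorphic_map[OF assms(1,2)] homeomorphic_imp_open_map open_map_def by blast
  moreover have "open (snd c ` fst c)"
    using assms(1,2) by (simp add: smooth_manifold_def is_chart_def)
  ultimately show ?thesis
    using openin_open_trans by blast
qed

lemma charts_at_nonempty: "smooth_manifold M \<Longrightarrow> x \<in> points M \<Longrightarrow> \<exists>c. c \<in> charts_at M x"
  unfolding smooth_manifold_def charts_at_def by blast

lemma transition_differentiable:
  assumes "smooth_manifold M" "c \<in> charts_at M x" "d \<in> charts_at M x"
  shows "(snd d \<circ> chart_inv c) differentiable (at (snd c x))"
  using assms unfolding smooth_manifold_def compatible_def charts_at_def
  by (intro smooth_on_differentiable[of "snd c ` (fst c \<inter> fst d)"]) auto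

lemma transition_linear:
  "smooth_manifold M \<Longrightarrow> c \<in> charts_at M x \<Longrightarrow> d \<in> charts_at M x \<Longrightarrow>
    linear (frechet_derivative (snd d \<circ> chart_inv c) (at (snd c x)))"
  by (intro linear_frechet_derivative transition_differentiable)

lemma tangent_space_component:
  "v \<in> tangent_space M x \<Longrightarrow> c \<in> charts_at M x \<Longrightarrow> d \<in> charts_at M x \<Longrightarrow>
    v d = frechet_derivative (snd d \<circ> chart_inv c) (at (snd c x)) (v c)"
  unfolding tangent_space_def by blast

lemma tangent_space_outside: "v \<in> tangent_space M x \<Longrightarrow> c \<notin> charts_at M x \<Longrightarrow> v c = 0"
  unfolding tangent_space_def by blast

lemma tangent_spaceI:
  assumes "\<And>c. c \<notin> charts_at M x \<Longrightarrow> v c = 0"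
    and "\<And>c d. c \<in> charts_at M x \<Longrightarrow> d \<in> charts_at M x \<Longrightarrow>
      v d = frechet_derivative (snd d \<circ> chart_inv c) (at (snd c x)) (v c)"
  shows "v \<in> tangent_space M x"
  using assms unfolding tangent_space_def by blast

lemma tangent_space_lincomb:
  assumes "smooth_manifold M" "v \<in> tangent_space M x" "w \<in> tangent_space M x"
  shows "a *\<^sub>R v + b *\<^sub>R w \<in> tangent_space M x"
proof (rule tangent_spaceI)
  fix c assume "c \<notin> charts_at M x"
  then show "(a *\<^sub>R v + b *\<^sub>R w) c = 0"
    using assms(2,3) by (simp add: scaleR_fun_def tangent_space_outside)
next
  fix c d assume cd: "c \<in> charts_at M x" "d \<in> charts_at M x"
  show "(a *\<^sub>R v + b *\<^sub>R w) d
      = frechet_derivative (snd d \<circ> chart_inv c) (at (snd c x)) ((a *\<^sub>R v + b *\<^sub>R w) c)"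
    by (simp add: scaleR_fun_def linear_add[OF transition_linear[OF assms(1) cd]]
        linear_cmul[OF transition_linear[OF assms(1) cd]]
        flip: tangent_space_component[OF assms(2) cd] tangent_space_component[OF assms(3) cd])
qed

lemma subspace_tangent_space:
  assumes "smooth_manifold M"
  shows "subspace (tangent_space M x)"
proof -
  have "0 \<in> tangent_space M x"
    by (rule tangent_spaceI) (simp_all add: linear_0[OF transition_linear[OF assms]])
  then show ?thesis
    using tangent_space_lincomb[OF assms, of _ x _ 1 1] tangent_space_lincomb[OF assms, of _ x _ _ 0]
    by (simp add: subspace_def)
qed

text \<open>A single chart around the point carries all information about a tangent vector; equalities of
  tangent vectors are checked in whichever chart is most convenient.\<close>

lemma tangent_eqI:
  assumes "v \<in> tangent_space M x" "w \<in> tangent_space M x" "c \<in> charts_at M x" "v c = w c"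
  shows "v = w"
proof
  fix d
  show "v d = w d"
  proof (cases "d \<in> charts_at M x")
    case True
    then show ?thesis
      using tangent_space_component[OF assms(1,3) True] tangent_space_component[OF assms(2,3) True]
        assms(4) by simp
  next
    case False
    then show ?thesis
      using assms(1,2) by (simp add: tangent_space_outside)
  qed
qed

lemma sum_fun_apply: "(\<Sum>i\<in>I. f i) x = (\<Sum>i\<in>I. f i x)"
  by (induction I rule: infinite_finite_induct) auto

lemma vector_field_onI:
  assumes "\<And>x. x \<in> U \<Longrightarrow> X x \<in> tangent_space M x"
    and "\<And>c. c \<in> atlas M \<Longrightarrow> smooth_on (snd c ` (U \<inter> fst c)) (\<lambda>u. X (chart_inv c u) c)"
  shows "vector_field_on M U X"
  using assms unfolding vector_field_on_def by blast

lemma vector_field_on_tangent: "vector_field_on M U X \<Longrightarrow> x \<in> U \<Longrightarrow> X x \<in> tangent_space M x"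
  unfolding vector_field_on_def by blast

lemma vector_field_on_smooth:
  "vector_field_on M U X \<Longrightarrow> c \<in> atlas M \<Longrightarrow> smooth_on (snd c ` (U \<inter> fst c)) (\<lambda>u. X (chart_inv c u) c)"
  unfolding vector_field_on_def by blast

lemma smooth_fun_on_smooth:
  "smooth_fun_on M U f \<Longrightarrow> c \<in> atlas M \<Longrightarrow> smooth_on (snd c ` (U \<inter> fst c)) (f \<circ> chart_inv c)"
  unfolding smooth_fun_on_def by blast

lemma vector_field_on_subset:
  assumes "vector_field_on M U X" "V \<subseteq> U"
  shows "vector_field_on M V X"
proof (rule vector_field_onI)
  show "X x \<in> tangent_space M x" if "x \<in> V" for x
    using vector_field_on_tangent[OF assms(1)] assms(2) that by blast
  show "smooth_on (snd c ` (V \<inter> fst c)) (\<lambda>u. X (chart_inv c u) c)" if "c \<in> atlas M" for c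
    using assms(2) by (intro smooth_on_subset[OF vector_field_on_smooth[OF assms(1) that]]) blast
qed

lemma smooth_fun_on_const: "smooth_fun_on M U (\<lambda>x. a)"
  unfolding smooth_fun_on_def o_def by (blast intro: smooth_on_const)

lemma smooth_fun_on_mult:
  assumes "smooth_manifold M" "openin (mtop M) U" "smooth_fun_on M U f" "smooth_fun_on M U g"
  shows "smooth_fun_on M U (\<lambda>x. f x * g x)"
  unfolding smooth_fun_on_def
proof
  fix c assume c: "c \<in> atlas M"
  show "smooth_on (snd c ` (U \<inter> fst c)) ((\<lambda>x. f x * g x) \<circ> chart_inv c)"
    using smooth_on_scaleR[OF chart_image_open[OF assms(1) c assms(2)]
        smooth_fun_on_smooth[OF assms(3) c] smooth_fun_on_smooth[OF assms(4) c]]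
    by (simp add: o_def)
qed

lemma vector_field_on_scaleR:
  assumes "smooth_manifold M" "openin (mtop M) U" "smooth_fun_on M U f" "vector_field_on M U X"
  shows "vector_field_on M U (\<lambda>x. f x *\<^sub>R X x)"
proof (rule vector_field_onI)
  show "f x *\<^sub>R X x \<in> tangent_space M x" if "x \<in> U" for x
    by (intro subspace_scale[OF subspace_tangent_space[OF assms(1)]]
        vector_field_on_tangent[OF assms(4) that])
next
  fix c assume c: "c \<in> atlas M"
  show "smooth_on (snd c ` (U \<inter> fst c)) (\<lambda>u. (f (chart_inv c u) *\<^sub>R X (chart_inv c u)) c)"
    using smooth_on_scaleR[OF chart_image_open[OF assms(1) c assms(2)]
        smooth_fun_on_smooth[OF assms(3) c] vector_field_on_smooth[OF assms(4) c]]
    by (simp add: o_def scaleR_fun_def)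
qed

lemma vector_field_on_sum:
  assumes "smooth_manifold M" "openin (mtop M) U" "\<And>i. i \<in> I \<Longrightarrow> vector_field_on M U (X i)"
  shows "vector_field_on M U (\<lambda>x. \<Sum>i\<in>I. X i x)"
proof (rule vector_field_onI)
  show "(\<Sum>i\<in>I. X i x) \<in> tangent_space M x" if "x \<in> U" for x
    by (intro subspace_sum[OF subspace_tangent_space[OF assms(1)]]
        vector_field_on_tangent[OF assms(3) that])
next
  fix c assume c: "c \<in> atlas M"
  show "smooth_on (snd c ` (U \<inter> fst c)) (\<lambda>u. (\<Sum>i\<in>I. X i (chart_inv c u)) c)"
    unfolding sum_fun_apply
    by (intro smooth_on_sum chart_image_open[OF assms(1) c assms(2)]
        vector_field_on_smooth[OF assms(3) c])
qed

section \<open>Directional derivatives\<close>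

lemma smooth_fun_differentiable:
  assumes "smooth_fun_on M U f" "x \<in> U" "c \<in> charts_at M x"
  shows "(f \<circ> chart_inv c) differentiable (at (snd c x))"
  using assms unfolding charts_at_def
  by (intro smooth_on_differentiable[OF smooth_fun_on_smooth[OF assms(1)]]) auto

text \<open>The chain rule for the coordinate change, whose Jacobian also transforms \<open>v\<close>. It allows the
  directional derivative to be computed in any chart instead of the one picked by choice.\<close>

lemma dir_deriv_change_chart:
  assumes M: "smooth_manifold M" and "openin (mtop M) U" "smooth_fun_on M U f" "x \<in> U"
    and v: "v \<in> tangent_space M x" and c: "c \<in> charts_at M x" and d: "d \<in> charts_at M x"
  shows "frechet_derivative (f \<circ> chart_inv c) (at (snd c x)) (v c)
    = frechet_derivative (f \<circ> chart_inv d) (at (snd d x)) (v d)"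
proof -
  have cd: "c \<in> atlas M" "d \<in> atlas M" "x \<in> fst c" "x \<in> fst d"
    using c d by (auto simp: charts_at_def)
  have x: "chart_inv c (snd c x) = x"
    using cd by (simp add: chart_inv_chart[OF M])
  have "frechet_derivative (f \<circ> chart_inv c) (at (snd c x))
    = frechet_derivative ((f \<circ> chart_inv d) \<circ> (snd d \<circ> chart_inv c)) (at (snd c x))"
  proof (rule frechet_derivative_cong_open[OF chart_image_open[OF M cd(1) chart_openin[OF M cd(2)]]])
    show "snd c x \<in> snd c ` (fst d \<inter> fst c)"
      using cd by blast
    show "(f \<circ> chart_inv c) y = ((f \<circ> chart_inv d) \<circ> (snd d \<circ> chart_inv c)) y"
      if "y \<in> snd c ` (fst d \<inter> fst c)" for y
      using that cd by (auto simp: chart_inv_chart[OF M])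
  qed
  also have "\<dots> = frechet_derivative (f \<circ> chart_inv d) (at (snd d x))
      \<circ> frechet_derivative (snd d \<circ> chart_inv c) (at (snd c x))"
    using transition_differentiable[OF M c d] smooth_fun_differentiable[OF assms(3,4) d]
    by (subst frechet_derivative_compose) (simp_all add: x)
  finally show ?thesis
    by (simp add: tangent_space_component[OF v c d])
qed

lemma dir_deriv_chart:
  assumes "smooth_manifold M" "openin (mtop M) U" "smooth_fun_on M U f" "x \<in> U"
    and "v \<in> tangent_space M x" "c \<in> charts_at M x"
  shows "dir_deriv M x v f = frechet_derivative (f \<circ> chart_inv c) (at (snd c x)) (v c)"
  unfolding dir_deriv_def Let_def
  using dir_deriv_change_chart[OF assms(1-5) someI[of "\<lambda>c. c \<in> charts_at M x", OF assms(6)] assms(6)] .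

lemma dir_deriv_const: "dir_deriv M x v (\<lambda>y. a) = 0"
  by (simp add: dir_deriv_def o_def frechet_derivative_const)

lemma dir_deriv_uminus:
  assumes M: "smooth_manifold M" "openin (mtop M) U" "smooth_fun_on M U f" "x \<in> U"
    and v: "v \<in> tangent_space M x"
  shows "dir_deriv M x v (\<lambda>y. - f y) = - dir_deriv M x v f"
proof -
  obtain c where c: "c \<in> charts_at M x"
    using charts_at_nonempty[OF M(1)] M(2,4) openin_subset by blast
  have "smooth_fun_on M U (\<lambda>y. - f y)"
    using smooth_fun_on_mult[OF M(1,2) smooth_fun_on_const[of M U "-1"] M(3)] by simp
  then have "dir_deriv M x v (\<lambda>y. - f y)
      = frechet_derivative (\<lambda>u. - (f \<circ> chart_inv c) u) (at (snd c x)) (v c)"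
    using dir_deriv_chart[OF M(1,2) _ M(4) v c] by (simp add: o_def)
  moreover have "((\<lambda>u. - (f \<circ> chart_inv c) u) has_derivative
      (\<lambda>w. - frechet_derivative (f \<circ> chart_inv c) (at (snd c x)) w)) (at (snd c x))"
    using smooth_fun_differentiable[OF M(3,4) c]
    by (intro has_derivative_minus) (simp flip: frechet_derivative_works add: comp_def)
  ultimately show ?thesis
    by (simp only: has_derivative_imp_frechet_derivative dir_deriv_chart[OF M v c])
qed

lemma lin_on_dir_deriv:
  assumes M: "smooth_manifold M" "openin (mtop M) U" "smooth_fun_on M U f" "x \<in> U"
  shows "lin_on (tangent_space M x) (\<lambda>v. dir_deriv M x v f)"
  unfolding lin_on_def
proof (intro ballI allI)
  fix v w a b assume vw: "v \<in> tangent_space M x" "w \<in> tangent_space M x"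
  obtain c where c: "c \<in> charts_at M x"
    using charts_at_nonempty[OF M(1)] M(2,4) openin_subset by blast
  have lin: "linear (frechet_derivative (f \<circ> chart_inv c) (at (snd c x)))"
    using smooth_fun_differentiable[OF M(3,4) c] linear_frechet_derivative by blast
  show "dir_deriv M x (a *\<^sub>R v + b *\<^sub>R w) f = a *\<^sub>R dir_deriv M x v f + b *\<^sub>R dir_deriv M x w f"
    using dir_deriv_chart[OF M vw(1) c] dir_deriv_chart[OF M vw(2) c]
      dir_deriv_chart[OF M tangent_space_lincomb[OF M(1) vw] c]
    by (simp add: linear_add[OF lin] linear_cmul[OF lin] scaleR_fun_def)
qed

lemma smooth_fun_on_dir_deriv:
  assumes M: "smooth_manifold M" "openin (mtop M) U" "smooth_fun_on M U f" "vector_field_on M U X"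
  shows "smooth_fun_on M U (\<lambda>x. dir_deriv M x (X x) f)"
  unfolding smooth_fun_on_def
proof
  fix c assume c: "c \<in> atlas M"
  have op: "open (snd c ` (U \<inter> fst c))"
    by (rule chart_image_open[OF M(1) c M(2)])
  show "smooth_on (snd c ` (U \<inter> fst c)) ((\<lambda>x. dir_deriv M x (X x) f) \<circ> chart_inv c)"
  proof (rule smooth_on_cong[OF op _ smooth_on_derivative_along[OF op
          smooth_fun_on_smooth[OF M(3) c] vector_field_on_smooth[OF M(4) c]]])
    fix u assume "u \<in> snd c ` (U \<inter> fst c)"
    then obtain x where x: "x \<in> U" "x \<in> fst c" "u = snd c x"
      by blast
    then show "frechet_derivative (f \<circ> chart_inv c) (at u) (X (chart_inv c u) c)
        = ((\<lambda>x. dir_deriv M x (X x) f) \<circ> chart_inv c) u"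
      using dir_deriv_chart[OF M(1-3) x(1) vector_field_on_tangent[OF M(4) x(1)], of c] c
      by (simp add: charts_at_def chart_inv_chart[OF M(1) c])
  qed
qed

section \<open>Linear maps, metrics and orthonormal frames\<close>

lemma lin_onD:
  "lin_on V f \<Longrightarrow> v \<in> V \<Longrightarrow> w \<in> V \<Longrightarrow> f (a *\<^sub>R v + b *\<^sub>R w) = a *\<^sub>R f v + b *\<^sub>R f w"
  unfolding lin_on_def by blast

lemma lin_on_add: "lin_on V f \<Longrightarrow> v \<in> V \<Longrightarrow> w \<in> V \<Longrightarrow> f (v + w) = f v + f w"
  using lin_onD[of V f v w 1 1] by simp

lemma lin_on_diff: "lin_on V f \<Longrightarrow> v \<in> V \<Longrightarrow> w \<in> V \<Longrightarrow> f (v - w) = f v - f w"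
  using lin_onD[of V f v w 1 "-1"] by simp

lemma lin_on_scaleR: "lin_on V f \<Longrightarrow> v \<in> V \<Longrightarrow> f (a *\<^sub>R v) = a *\<^sub>R f v"
  using lin_onD[of V f v v a 0] by simp

lemma lin_on_uminus: "lin_on V f \<Longrightarrow> v \<in> V \<Longrightarrow> f (- v) = - f v"
  using lin_on_scaleR[of V f v "-1"] by simp

lemma lin_on_zero: "lin_on V f \<Longrightarrow> subspace V \<Longrightarrow> f 0 = 0"
  using lin_on_scaleR[of V f 0 0] subspace_0[of V] by simp

lemma lin_on_sum:
  assumes "lin_on V f" "subspace V" "\<And>i. i \<in> I \<Longrightarrow> v i \<in> V"
  shows "f (\<Sum>i\<in>I. v i) = (\<Sum>i\<in>I. f (v i))"
  using assms(3)
proof (induction I rule: infinite_finite_induct)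
  case (insert i I)
  then have "(\<Sum>i\<in>I. v i) \<in> V"
    by (intro subspace_sum[OF assms(2)]) blast
  then show ?case
    using insert by (simp add: lin_on_add[OF assms(1)])
qed (simp_all add: lin_on_zero[OF assms(1,2)])

lemma lin_on_lincomb:
  assumes "lin_on V f" "subspace V" "\<And>i. i \<in> I \<Longrightarrow> v i \<in> V"
  shows "f (\<Sum>i\<in>I. a i *\<^sub>R v i) = (\<Sum>i\<in>I. a i *\<^sub>R f (v i))"
  using lin_on_sum[OF assms(1,2), of I "\<lambda>i. a i *\<^sub>R v i"] assms(2,3)
  by (simp add: subspace_scale lin_on_scaleR[OF assms(1)])

lemma pseudo_riemannian_smooth_manifold: "pseudo_riemannian M g \<Longrightarrow> smooth_manifold M"
  unfolding pseudo_riemannian_def by blast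

lemma lin_on_metric:
  "pseudo_riemannian M g \<Longrightarrow> x \<in> points M \<Longrightarrow> v \<in> tangent_space M x \<Longrightarrow> lin_on (tangent_space M x) (g x v)"
  unfolding pseudo_riemannian_def by simp

lemma metric_sym:
  "pseudo_riemannian M g \<Longrightarrow> x \<in> points M \<Longrightarrow> v \<in> tangent_space M x \<Longrightarrow> w \<in> tangent_space M x \<Longrightarrow>
    g x v w = g x w v"
  unfolding pseudo_riemannian_def by simp

lemma metric_nondegenerate:
  "pseudo_riemannian M g \<Longrightarrow> x \<in> points M \<Longrightarrow> v \<in> tangent_space M x \<Longrightarrow>
    (\<And>w. w \<in> tangent_space M x \<Longrightarrow> g x v w = 0) \<Longrightarrow> v = 0"
  unfolding pseudo_riemannian_def by simp

lemma metric_smooth: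
  "pseudo_riemannian M g \<Longrightarrow> openin (mtop M) U \<Longrightarrow> vector_field_on M U X \<Longrightarrow> vector_field_on M U Y \<Longrightarrow>
    smooth_fun_on M U (\<lambda>x. g x (X x) (Y x))"
  unfolding pseudo_riemannian_def by simp

lemma lin_on_metric_left:
  assumes g: "pseudo_riemannian M g" "x \<in> points M" "w \<in> tangent_space M x"
  shows "lin_on (tangent_space M x) (\<lambda>v. g x v w)"
  unfolding lin_on_def
proof (intro ballI allI)
  fix u v a b assume uv: "u \<in> tangent_space M x" "v \<in> tangent_space M x"
  have "a *\<^sub>R u + b *\<^sub>R v \<in> tangent_space M x"
    by (rule tangent_space_lincomb[OF pseudo_riemannian_smooth_manifold[OF g(1)] uv])
  then have "g x (a *\<^sub>R u + b *\<^sub>R v) w = g x w (a *\<^sub>R u + b *\<^sub>R v)"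
    using metric_sym[OF g(1,2)] g(3) by blast
  also have "\<dots> = a *\<^sub>R g x w u + b *\<^sub>R g x w v"
    using lin_on_metric[OF g(1-3)] uv unfolding lin_on_def by blast
  finally show "g x (a *\<^sub>R u + b *\<^sub>R v) w = a *\<^sub>R g x u w + b *\<^sub>R g x v w"
    using metric_sym[OF g(1,2) g(3)] uv by simp
qed

lemma frame_openin: "local_orthonormal_frame M g U E \<Longrightarrow> openin (mtop M) U"
  unfolding local_orthonormal_frame_def by blast

lemma frame_vector_field: "local_orthonormal_frame M g U E \<Longrightarrow> vector_field_on M U (E i)"
  unfolding local_orthonormal_frame_def by blast

lemma frame_sign_square:
  "local_orthonormal_frame M g U E \<Longrightarrow> x \<in> U \<Longrightarrow> g x (E i x) (E i x) * g x (E i x) (E i x) = 1"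
proof -
  assume "local_orthonormal_frame M g U E" "x \<in> U"
  then have "if i = i then g x (E i x) (E i x) \<in> {1, -1} else g x (E i x) (E i x) = 0"
    unfolding local_orthonormal_frame_def by blast
  then show ?thesis
    by auto
qed

lemma frame_orthogonal:
  "local_orthonormal_frame M g U E \<Longrightarrow> x \<in> U \<Longrightarrow> i \<noteq> j \<Longrightarrow> g x (E i x) (E j x) = 0"
  unfolding local_orthonormal_frame_def by simp

text \<open>Orthonormality makes the \<open>n\<close> frame vectors linearly independent, and the coordinates in a chart
  embed the tangent space into \<open>real ^ 'n\<close>, so a dimension count makes them a basis; pairing with
  \<open>E i\<close> then reads off the coefficients.\<close>

lemma frame_expansion:
  fixes M :: "('a, 'n::finite) manifold"
  assumes g: "pseudo_riemannian M g" and E: "local_orthonormal_frame M g U E"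
    and x: "x \<in> U" and v: "v \<in> tangent_space M x"
  shows "v = (\<Sum>i\<in>UNIV. (g x (E i x) (E i x) * g x v (E i x)) *\<^sub>R E i x)"
proof -
  note M = pseudo_riemannian_smooth_manifold[OF g]
  have xM: "x \<in> points M"
    using frame_openin[OF E] x openin_subset by blast
  have ET: "E i x \<in> tangent_space M x" for i
    using vector_field_on_tangent[OF frame_vector_field[OF E] x] .
  have sT: "(\<Sum>i\<in>UNIV. a i *\<^sub>R E i x) \<in> tangent_space M x" for a
    by (intro subspace_sum subspace_scale subspace_tangent_space[OF M] ET)
  have coeff: "g x (\<Sum>i\<in>UNIV. a i *\<^sub>R E i x) (E j x) = a j * g x (E j x) (E j x)" for a j
  proof -
    have "g x (\<Sum>i\<in>UNIV. a i *\<^sub>R E i x) (E j x) = (\<Sum>i\<in>UNIV. a i * g x (E i x) (E j x))"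
      using lin_on_lincomb[OF lin_on_metric_left[OF g xM ET] subspace_tangent_space[OF M],
          where I = UNIV and v = "\<lambda>i. E i x" and a = a] ET by simp
    also have "\<dots> = (\<Sum>i\<in>UNIV. if i = j then a j * g x (E j x) (E j x) else 0)"
      by (rule sum.cong) (auto simp: frame_orthogonal[OF E x])
    finally show ?thesis
      by simp
  qed
  obtain c where c: "c \<in> charts_at M x"
    using charts_at_nonempty[OF M xM] by blast
  define B where "B = (\<lambda>i. E i x c)"
  have comb: "(\<Sum>i\<in>UNIV. a i *\<^sub>R E i x) c = (\<Sum>i\<in>UNIV. a i *\<^sub>R B i)" for a
    by (simp add: sum_fun_apply scaleR_fun_def B_def)
  have zero: "a j = 0" if "(\<Sum>i\<in>UNIV. a i *\<^sub>R B i) = 0" for a j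
  proof -
    have "(\<Sum>i\<in>UNIV. a i *\<^sub>R E i x) = 0"
      using tangent_eqI[OF sT subspace_0[OF subspace_tangent_space[OF M]] c] comb that by simp
    then have "a j * g x (E j x) (E j x) = 0"
      using coeff[of a j] lin_on_zero[OF lin_on_metric_left[OF g xM ET] subspace_tangent_space[OF M]]
      by simp
    then show ?thesis
      using frame_sign_square[OF E x, of j] by auto
  qed
  \<comment> \<open>A map \<open>real ^ 'n \<Rightarrow> real ^ 'n\<close> with trivial kernel is onto.\<close>
  have lin: "linear (\<lambda>a. \<Sum>i\<in>UNIV. a $ i *\<^sub>R B i)"
    by (rule linearI) (simp_all add: scaleR_left_distrib sum.distrib scaleR_sum_right)
  have "inj (\<lambda>a::real^'n. \<Sum>i\<in>UNIV. a $ i *\<^sub>R B i)"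
    unfolding linear_injective_0[OF lin] using zero by (simp add: vec_eq_iff)
  then have "surj (\<lambda>a::real^'n. \<Sum>i\<in>UNIV. a $ i *\<^sub>R B i)"
    using lin linear_injective_imp_surjective by blast
  then obtain a :: "real^'n" where a: "v c = (\<Sum>i\<in>UNIV. a $ i *\<^sub>R B i)"
    by (meson surjD)
  have va: "v = (\<Sum>i\<in>UNIV. a $ i *\<^sub>R E i x)"
    by (rule tangent_eqI[OF v sT c]) (simp only: a comb)
  have aj: "a $ j = g x (E j x) (E j x) * g x v (E j x)" for j
  proof -
    have "g x v (E j x) = a $ j * g x (E j x) (E j x)"
      unfolding va by (rule coeff)
    then show ?thesis
      using frame_sign_square[OF E x, of j] by (simp add: mult.left_commute)
  qed
  from va show ?thesis
    unfolding aj .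
qed

text \<open>Torsion-freeness and metricity constrain a connection through vector fields. Combining a frame with
  constant coefficients turns such statements into ones about tangent vectors at a point.\<close>

lemma tangent_vector_extends:
  assumes g: "pseudo_riemannian M g" and E: "local_orthonormal_frame M g U E"
    and x: "x \<in> U" and v: "v \<in> tangent_space M x"
  obtains X where "vector_field_on M U X" "X x = v"
proof -
  have "vector_field_on M U (\<lambda>y. \<Sum>i\<in>UNIV. (g x (E i x) (E i x) * g x v (E i x)) *\<^sub>R E i y)"
    by (intro vector_field_on_sum vector_field_on_scaleR pseudo_riemannian_smooth_manifold[OF g]
        frame_openin[OF E] frame_vector_field[OF E] smooth_fun_on_const)
  then show thesis
    using frame_expansion[OF assms, symmetric] by (rule that)
qed

text \<open>Nondegeneracy of the metric makes the description of the gradient unique.\<close>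

lemma grad_eqI:
  assumes g: "pseudo_riemannian M g" and x: "x \<in> points M" and v: "v \<in> tangent_space M x"
    and eq: "\<And>w. w \<in> tangent_space M x \<Longrightarrow> g x v w = dir_deriv M x w f"
  shows "grad M g f x = v"
  unfolding grad_def
proof (rule the_equality)
  show "v \<in> tangent_space M x \<and> (\<forall>w\<in>tangent_space M x. g x v w = dir_deriv M x w f)"
    using v eq by blast
  fix u assume u: "u \<in> tangent_space M x \<and> (\<forall>w\<in>tangent_space M x. g x u w = dir_deriv M x w f)"
  then have uv: "u - v \<in> tangent_space M x"
    using v subspace_diff[OF subspace_tangent_space[OF pseudo_riemannian_smooth_manifold[OF g]]] by blast
  have "u - v = 0"
  proof (rule metric_nondegenerate[OF g x uv])
    fix w assume "w \<in> tangent_space M x"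
    then show "g x (u - v) w = 0"
      using u v eq by (simp add: lin_on_diff[OF lin_on_metric_left[OF g x]])
  qed
  then show "u = v"
    by simp
qed

text \<open>The gradient exists because its frame expansion can be written down; the same formula makes it
  smooth.\<close>

lemma grad_frame:
  fixes M :: "('a, 'n::finite) manifold"
  assumes g: "pseudo_riemannian M g" and E: "local_orthonormal_frame M g U E"
    and f: "smooth_fun_on M U f" and x: "x \<in> U"
  shows "grad M g f x = (\<Sum>i\<in>UNIV. (g x (E i x) (E i x) * dir_deriv M x (E i x) f) *\<^sub>R E i x)"
    and "\<And>w. w \<in> tangent_space M x \<Longrightarrow> g x (grad M g f x) w = dir_deriv M x w f"
proof -
  note M = pseudo_riemannian_smooth_manifold[OF g]
  have xM: "x \<in> points M"
    using frame_openin[OF E] x openin_subset by blast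
  note T = subspace_tangent_space[OF M, of x]
  have ET: "E i x \<in> tangent_space M x" for i
    using vector_field_on_tangent[OF frame_vector_field[OF E] x] .
  define v where "v = (\<Sum>i\<in>UNIV. (g x (E i x) (E i x) * dir_deriv M x (E i x) f) *\<^sub>R E i x)"
  have v: "v \<in> tangent_space M x"
    unfolding v_def by (intro subspace_sum subspace_scale T ET)
  have eq: "g x v w = dir_deriv M x w f" if w: "w \<in> tangent_space M x" for w
  proof -
    note df = lin_on_dir_deriv[OF M frame_openin[OF E] f x]
    have "g x v w = (\<Sum>i\<in>UNIV. g x (E i x) (E i x) * dir_deriv M x (E i x) f * g x (E i x) w)"
      unfolding v_def using lin_on_lincomb[OF lin_on_metric_left[OF g xM w] T,
          of UNIV "\<lambda>i. E i x" "\<lambda>i. g x (E i x) (E i x) * dir_deriv M x (E i x) f"] ET by simp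
    also have "\<dots> = (\<Sum>i\<in>UNIV. (g x (E i x) (E i x) * g x w (E i x)) *\<^sub>R dir_deriv M x (E i x) f)"
      by (rule sum.cong) (simp_all add: metric_sym[OF g xM ET w])
    also have "\<dots> = dir_deriv M x (\<Sum>i\<in>UNIV. (g x (E i x) (E i x) * g x w (E i x)) *\<^sub>R E i x) f"
      using lin_on_lincomb[OF df T, of UNIV "\<lambda>i. E i x"] ET by simp
    finally show ?thesis
      using frame_expansion[OF g E x w] by simp
  qed
  then show grad: "grad M g f x = (\<Sum>i\<in>UNIV. (g x (E i x) (E i x) * dir_deriv M x (E i x) f) *\<^sub>R E i x)"
    using grad_eqI[OF g xM v] by (simp add: v_def)
  show "g x (grad M g f x) w = dir_deriv M x w f" if "w \<in> tangent_space M x" for w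
    using eq[OF that] by (simp add: grad v_def)
qed

lemma vector_field_on_cong:
  assumes M: "smooth_manifold M" and U: "openin (mtop M) U"
    and eq: "\<And>x. x \<in> U \<Longrightarrow> X x = Y x" and X: "vector_field_on M U X"
  shows "vector_field_on M U Y"
proof (rule vector_field_onI)
  show "Y x \<in> tangent_space M x" if "x \<in> U" for x
    using vector_field_on_tangent[OF X that] eq[OF that] by simp
  fix c assume c: "c \<in> atlas M"
  show "smooth_on (snd c ` (U \<inter> fst c)) (\<lambda>u. Y (chart_inv c u) c)"
    by (rule smooth_on_cong[OF chart_image_open[OF M c U] _ vector_field_on_smooth[OF X c]])
      (auto simp: chart_inv_chart[OF M c] eq)
qed

lemma vector_field_on_grad:
  fixes M :: "('a, 'n::finite) manifold"
  assumes g: "pseudo_riemannian M g" and E: "local_orthonormal_frame M g U E"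
    and f: "smooth_fun_on M U f"
  shows "vector_field_on M U (grad M g f)"
proof (rule vector_field_on_cong[OF pseudo_riemannian_smooth_manifold[OF g] frame_openin[OF E]])
  show "vector_field_on M U (\<lambda>x. \<Sum>i\<in>UNIV. (g x (E i x) (E i x) * dir_deriv M x (E i x) f) *\<^sub>R E i x)"
    by (intro vector_field_on_sum vector_field_on_scaleR smooth_fun_on_mult smooth_fun_on_dir_deriv
        pseudo_riemannian_smooth_manifold[OF g] metric_smooth[OF g]
        frame_openin[OF E] frame_vector_field[OF E] f)
qed (rule grad_frame(1)[OF g E f, symmetric])

section \<open>Diffeomorphisms\<close>

definition pullback_chart :: "('a, 'n) manifold \<Rightarrow> ('a \<Rightarrow> 'b) \<Rightarrow> ('b, 'n) chart \<Rightarrow> ('a, 'n) chart"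
  where "pullback_chart M \<phi> d = ({x \<in> points M. \<phi> x \<in> fst d}, snd d \<circ> \<phi>)"

text \<open>A diffeomorphism is kept together with its inverse \<open>\<psi>\<close>, specified on the points only. This makes the
  notion symmetric, so that each result about \<open>\<phi>\<close> can be applied to \<open>\<psi>\<close>.\<close>

locale diffeo_pair =
  fixes M :: "('a, 'n::finite) manifold" and N :: "('b, 'n) manifold"
    and \<phi> :: "'a \<Rightarrow> 'b" and \<psi> :: "'b \<Rightarrow> 'a"
  assumes M: "smooth_manifold M" and N: "smooth_manifold N"
    and \<phi>_points: "\<And>x. x \<in> points M \<Longrightarrow> \<phi> x \<in> points N"
    and \<psi>_points: "\<And>y. y \<in> points N \<Longrightarrow> \<psi> y \<in> points M"
    and \<psi>_\<phi>: "\<And>x. x \<in> points M \<Longrightarrow> \<psi> (\<phi> x) = x"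
    and \<phi>_\<psi>: "\<And>y. y \<in> points N \<Longrightarrow> \<phi> (\<psi> y) = y"
    and \<phi>_smooth: "smooth_map M N \<phi>" and \<psi>_smooth: "smooth_map N M \<psi>"
begin

lemma diffeo_pair_inverse: "diffeo_pair N M \<psi> \<phi>"
  by unfold_locales
    (simp_all add: M N \<phi>_points \<psi>_points \<psi>_\<phi> \<phi>_\<psi> \<phi>_smooth \<psi>_smooth)

abbreviation pb :: "('b, 'n) chart \<Rightarrow> ('a, 'n) chart"
  where "pb \<equiv> pullback_chart M \<phi>"

lemma image_eq_preimage: "U \<subseteq> points M \<Longrightarrow> \<phi> ` U = {y \<in> points N. \<psi> y \<in> U}"
proof (intro equalityI subsetI)
  fix y assume "U \<subseteq> points M" "y \<in> \<phi> ` U"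
  then show "y \<in> {y \<in> points N. \<psi> y \<in> U}"
    using \<phi>_points \<psi>_\<phi> by auto
next
  fix y assume "y \<in> {y \<in> points N. \<psi> y \<in> U}"
  then show "y \<in> \<phi> ` U"
    using \<phi>_\<psi>[of y] by (intro image_eqI[of _ _ "\<psi> y"]) simp_all
qed

lemma openin_image: "openin (mtop M) U \<Longrightarrow> openin (mtop N) (\<phi> ` U)"
  using \<psi>_smooth openin_continuous_map_preimage[of "mtop N" "mtop M" \<psi> U]
  by (simp add: image_eq_preimage openin_subset smooth_map_def)

lemma image_pb_domain:
  assumes "A \<subseteq> points M"
  shows "\<phi> ` (A \<inter> fst (pb d)) = \<phi> ` A \<inter> fst d"
  using assms by (auto simp: pullback_chart_def)

lemma pb_image:
  assumes "A \<subseteq> points M"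
  shows "snd (pb d) ` (A \<inter> fst (pb d)) = snd d ` (\<phi> ` A \<inter> fst d)"
proof -
  have "snd (pb d) ` (A \<inter> fst (pb d)) = snd d ` \<phi> ` (A \<inter> fst (pb d))"
    unfolding pullback_chart_def by (simp add: image_comp)
  then show ?thesis
    by (simp only: image_pb_domain[OF assms])
qed

lemma image_points: "\<phi> ` points M = points N"
  unfolding image_eq_preimage[OF order_refl] using \<psi>_points by blast

lemma image_pb:
  assumes "d \<in> atlas N"
  shows "\<phi> ` fst (pb d) = fst d"
proof -
  have "points M \<inter> fst (pb d) = fst (pb d)"
    by (auto simp: pullback_chart_def)
  moreover have "points N \<inter> fst d = fst d"
    using chart_subset_points[OF N assms] by blast
  ultimately show ?thesis
    using image_pb_domain[OF order_refl, of d] by (simp only: image_points)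
qed

lemma snd_image_pb:
  assumes "d \<in> atlas N"
  shows "snd (pb d) ` fst (pb d) = snd d ` fst d"
proof -
  have "snd (pb d) ` fst (pb d) = snd d ` \<phi> ` fst (pb d)"
    by (simp add: pullback_chart_def image_comp)
  then show ?thesis
    by (simp only: image_pb[OF assms])
qed

lemma pb_inj_on:
  assumes "d \<in> atlas N"
  shows "inj_on (snd (pb d)) (fst (pb d))"
proof (rule inj_onI)
  fix x y assume xy: "x \<in> fst (pb d)" "y \<in> fst (pb d)" "snd (pb d) x = snd (pb d) y"
  then have "\<phi> x = \<phi> y"
    using inj_onD[OF chart_inj_on[OF N assms], of "\<phi> x" "\<phi> y"] by (simp add: pullback_chart_def)
  then have "\<psi> (\<phi> x) = \<psi> (\<phi> y)"
    by (simp only:)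
  then show "x = y"
    using xy(1,2) by (simp add: pullback_chart_def \<psi>_\<phi>)
qed

lemma chart_inv_pb:
  assumes d: "d \<in> atlas N" and y: "y \<in> fst d"
  shows "chart_inv (pb d) (snd d y) = \<psi> y"
proof -
  have yN: "y \<in> points N"
    using chart_subset_points[OF N d] y by blast
  have "\<psi> y \<in> fst (pb d)" "snd (pb d) (\<psi> y) = snd d y"
    using y yN by (simp_all add: pullback_chart_def \<psi>_points \<phi>_\<psi>)
  then show ?thesis
    using inv_into_f_f[OF pb_inj_on[OF d]] by metis
qed

text \<open>The atlas is maximal, so it contains the pulled-back charts: their transition maps to the
  charts of \<open>M\<close> are the coordinate expressions of \<open>\<phi>\<close> and of its inverse.\<close>

lemma pullback_chart_in_atlas:
  assumes d: "d \<in> atlas N"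
  shows "pb d \<in> atlas M"
proof -
  have dN: "fst d \<subseteq> points N"
    by (rule chart_subset_points[OF N d])
  have cont: "continuous_map (mtop M) (mtop N) \<phi>"
    using \<phi>_smooth by (simp add: smooth_map_def)
  have op: "openin (mtop M) (fst (pb d))"
    using openin_continuous_map_preimage[OF cont chart_openin[OF N d]]
    by (simp add: pullback_chart_def)
  then have sub: "fst (pb d) \<subseteq> points M"
    by (rule openin_subset)
  have "homeomorphic_maps (mtop M) (mtop N) \<phi> \<psi>"
    using \<phi>_smooth \<psi>_smooth \<psi>_\<phi> \<phi>_\<psi> by (simp add: homeomorphic_maps_def smooth_map_def)
  then have "homeomorphic_map (subtopology (mtop M) (fst (pb d))) (subtopology (mtop N) (fst d)) \<phi>"
    using homeomorphic_map_maps image_pb[OF d] sub dN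
    by (intro homeomorphic_map_subtopologies) (auto simp: Int_absorb1)
  then have "homeomorphic_map (subtopology (mtop M) (fst (pb d))) (top_of_set (snd d ` fst d)) (snd d \<circ> \<phi>)"
    by (rule homeomorphic_map_compose[OF _ chart_homeomorphic_map[OF N d]])
  then have "homeomorphic_map (subtopology (mtop M) (fst (pb d)))
      (top_of_set (snd (pb d) ` fst (pb d))) (snd (pb d))"
    by (simp only: snd_image_pb[OF d]) (simp add: pullback_chart_def)
  then have chart: "is_chart (mtop M) (pb d)"
    using op chart_image_open[OF N d chart_openin[OF N d]] snd_image_pb[OF d]
    by (simp add: is_chart_def)
  have "compatible (pb d) e" if e: "e \<in> atlas M" for e
    unfolding compatible_def
  proof
    have eM: "fst e \<subseteq> points M"
      by (rule chart_subset_points[OF M e])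
    have "snd (pb d) ` (fst (pb d) \<inter> fst e) = snd d ` (\<phi> ` fst e \<inter> fst d)"
      using pb_image[OF eM] by (simp add: Int_commute)
    also have "\<phi> ` fst e \<inter> fst d = fst d \<inter> \<psi> -` fst e"
      using image_eq_preimage[OF eM] dN by auto
    finally have dom: "snd (pb d) ` (fst (pb d) \<inter> fst e) = snd d ` (fst d \<inter> \<psi> -` fst e)" .
    have "open (snd d ` (\<phi> ` fst e \<inter> fst d))"
      by (rule chart_image_open[OF N d openin_image[OF chart_openin[OF M e]]])
    then have op: "open (snd d ` (fst d \<inter> \<psi> -` fst e))"
      by (simp add: \<open>\<phi> ` fst e \<inter> fst d = fst d \<inter> \<psi> -` fst e\<close>)
    show "smooth_on (snd (pb d) ` (fst (pb d) \<inter> fst e)) (snd e \<circ> chart_inv (pb d))"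
      unfolding dom
    proof (rule smooth_on_cong[OF op])
      show "smooth_on (snd d ` (fst d \<inter> \<psi> -` fst e)) (snd e \<circ> \<psi> \<circ> chart_inv d)"
        using \<psi>_smooth d e by (simp add: smooth_map_def)
      show "(snd e \<circ> \<psi> \<circ> chart_inv d) u = (snd e \<circ> chart_inv (pb d)) u"
        if "u \<in> snd d ` (fst d \<inter> \<psi> -` fst e)" for u
        using that by (auto simp: chart_inv_pb[OF d] chart_inv_chart[OF N d])
    qed
    have "snd e ` (fst (pb d) \<inter> fst e) = snd e ` (fst e \<inter> \<phi> -` fst d)"
      using eM by (intro arg_cong[of _ _ "image (snd e)"]) (auto simp: pullback_chart_def)
    moreover have "smooth_on (snd e ` (fst e \<inter> \<phi> -` fst d)) (snd d \<circ> \<phi> \<circ> chart_inv e)"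
      using \<phi>_smooth d e by (simp add: smooth_map_def)
    ultimately show "smooth_on (snd e ` (fst (pb d) \<inter> fst e)) (snd (pb d) \<circ> chart_inv e)"
      by (simp add: pullback_chart_def)
  qed
  then show ?thesis
    using M chart unfolding smooth_manifold_def by blast
qed

lemma pb_charts_at: "x \<in> points M \<Longrightarrow> d \<in> charts_at N (\<phi> x) \<Longrightarrow> pb d \<in> charts_at M x"
  using pullback_chart_in_atlas by (simp add: charts_at_def) (simp add: pullback_chart_def)

lemma pb_at: "snd (pb d) x = snd d (\<phi> x)"
  by (simp add: pullback_chart_def)

text \<open>In the chart \<open>d\<close> and its pullback, \<open>\<phi>\<close> is the identity map, hence so is its differential. All
  naturality statements below follow from this formula by comparing components.\<close>

lemma differential_component:
  assumes x: "x \<in> points M" and v: "v \<in> tangent_space M x"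
  shows "differential M N \<phi> x v d = (if d \<in> charts_at N (\<phi> x) then v (pb d) else 0)"
proof (cases "d \<in> charts_at N (\<phi> x)")
  case True
  have "(SOME c. c \<in> charts_at M x) \<in> charts_at M x"
    by (rule someI_ex[OF charts_at_nonempty[OF M x]])
  from tangent_space_component[OF v this pb_charts_at[OF x True]]
  show ?thesis
    using True by (simp add: differential_def Let_def) (simp add: pullback_chart_def)
next
  case False
  then show ?thesis
    by (simp add: differential_def)
qed

lemma differential_tangent:
  assumes x: "x \<in> points M" and v: "v \<in> tangent_space M x"
  shows "differential M N \<phi> x v \<in> tangent_space N (\<phi> x)"
proof (rule tangent_spaceI)
  show "differential M N \<phi> x v d = 0" if "d \<notin> charts_at N (\<phi> x)" for d
    using that by (simp add: differential_component[OF x v])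
  fix d e assume de: "d \<in> charts_at N (\<phi> x)" "e \<in> charts_at N (\<phi> x)"
  have d: "d \<in> atlas N" "\<phi> x \<in> fst d"
    using de(1) by (simp_all add: charts_at_def)
  have "frechet_derivative (snd (pb e) \<circ> chart_inv (pb d)) (at (snd d (\<phi> x)))
      = frechet_derivative (snd e \<circ> chart_inv d) (at (snd d (\<phi> x)))"
  proof (rule frechet_derivative_cong_open[OF chart_image_open[OF N d(1) chart_openin[OF N d(1)]]])
    show "snd d (\<phi> x) \<in> snd d ` (fst d \<inter> fst d)"
      using d(2) by simp
    show "(snd (pb e) \<circ> chart_inv (pb d)) u = (snd e \<circ> chart_inv d) u"
      if "u \<in> snd d ` (fst d \<inter> fst d)" for u
      using that chart_subset_points[OF N d(1)] 
      by (auto simp: chart_inv_pb[OF d(1)] chart_inv_chart[OF N d(1)] pb_at \<phi>_\<psi>)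
  qed
  then show "differential M N \<phi> x v e
      = frechet_derivative (snd e \<circ> chart_inv d) (at (snd d (\<phi> x))) (differential M N \<phi> x v d)"
    using de tangent_space_component[OF v pb_charts_at[OF x de(1)] pb_charts_at[OF x de(2)]]
    by (simp only: differential_component[OF x v] if_True pb_at)
qed

lemma lin_on_differential:
  assumes x: "x \<in> points M"
  shows "lin_on (tangent_space M x) (differential M N \<phi> x)"
  unfolding lin_on_def
proof (intro ballI allI ext)
  fix v w a b d assume vw: "v \<in> tangent_space M x" "w \<in> tangent_space M x"
  show "differential M N \<phi> x (a *\<^sub>R v + b *\<^sub>R w) d
      = (a *\<^sub>R differential M N \<phi> x v + b *\<^sub>R differential M N \<phi> x w) d"
    using differential_component[OF x vw(1)] differential_component[OF x vw(2)]
      differential_component[OF x tangent_space_lincomb[OF M vw]]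
    by (simp add: scaleR_fun_def)
qed

text \<open>Pulling a chart back along \<open>\<psi>\<close> and then along \<open>\<phi>\<close> changes its coordinate map at most outside its
  domain, so the coordinate change to the original chart has the identity as its derivative.\<close>

lemma differential_inverse:
  assumes x: "x \<in> points M" and v: "v \<in> tangent_space M x"
  shows "differential N M \<psi> (\<phi> x) (differential M N \<phi> x v) = v"
proof -
  interpret inv: diffeo_pair N M \<psi> \<phi>
    by (rule diffeo_pair_inverse)
  obtain c where c: "c \<in> charts_at M x"
    using charts_at_nonempty[OF M x] by blast
  have cM: "c \<in> atlas M" "x \<in> fst c"
    using c by (simp_all add: charts_at_def)
  have y: "\<phi> x \<in> points N" and yx: "\<psi> (\<phi> x) = x"
    using x \<phi>_points \<psi>_\<phi> by blast+
  have w: "differential M N \<phi> x v \<in> tangent_space N (\<phi> x)"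
    by (rule differential_tangent[OF x v])
  have c': "inv.pb c \<in> charts_at N (\<phi> x)"
    using inv.pb_charts_at[OF y, of c] c yx by simp
  have "v (pb (inv.pb c))
      = frechet_derivative (snd (pb (inv.pb c)) \<circ> chart_inv c) (at (snd c x)) (v c)"
    by (rule tangent_space_component[OF v c pb_charts_at[OF x c']])
  also have "frechet_derivative (snd (pb (inv.pb c)) \<circ> chart_inv c) (at (snd c x))
      = frechet_derivative (\<lambda>u. u) (at (snd c x))"
  proof (rule frechet_derivative_cong_open[OF chart_image_open[OF M cM(1) chart_openin[OF M cM(1)]]])
    show "snd c x \<in> snd c ` (fst c \<inter> fst c)"
      using cM(2) by simp
    show "(snd (pb (inv.pb c)) \<circ> chart_inv c) u = u" if "u \<in> snd c ` (fst c \<inter> fst c)" for u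
      using that chart_subset_points[OF M cM(1)]
      by (auto simp: chart_inv_chart[OF M cM(1)] pb_at inv.pb_at \<psi>_\<phi>)
  qed
  finally have "v (pb (inv.pb c)) = v c"
    by (simp add: frechet_derivative_ident)
  then have eq: "differential N M \<psi> (\<phi> x) (differential M N \<phi> x v) c = v c"
    using inv.differential_component[OF y w, of c] differential_component[OF x v, of "inv.pb c"] c c' yx
    by simp
  have "differential N M \<psi> (\<phi> x) (differential M N \<phi> x v) \<in> tangent_space M x"
    using inv.differential_tangent[OF y w] yx by simp
  from this v c eq show ?thesis
    by (rule tangent_eqI)
qed

text \<open>Relatedness along \<open>\<phi>\<close> takes the place of equality with a push-forward: the latter is a total
  function, whereas the fields are only controlled on an open set.\<close>

definition related :: "'a set \<Rightarrow> ('a \<Rightarrow> ('a, 'n) tvec) \<Rightarrow> ('b \<Rightarrow> ('b, 'n) tvec) \<Rightarrow> bool"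
  where "related U X X' \<longleftrightarrow> (\<forall>x\<in>U. X' (\<phi> x) = differential M N \<phi> x (X x))"

lemma related_field_component:
  assumes U: "U \<subseteq> points M" and X: "vector_field_on M U X" "related U X X'"
    and d: "d \<in> atlas N" and u: "u \<in> snd d ` (\<phi> ` U \<inter> fst d)"
  shows "X (chart_inv (pb d) u) (pb d) = X' (chart_inv d u) d"
proof -
  obtain x where x: "x \<in> U" "\<phi> x \<in> fst d" "u = snd d (\<phi> x)"
    using u by blast
  then have xM: "x \<in> points M" and dx: "d \<in> charts_at N (\<phi> x)"
    using U d by (auto simp: charts_at_def)
  show ?thesis
    using x X(2) differential_component[OF xM vector_field_on_tangent[OF X(1) x(1)], of d] dx
    by (simp add: related_def chart_inv_chart[OF N d] chart_inv_pb[OF d] \<psi>_\<phi>[OF xM])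
qed

lemma related_vector_field:
  assumes U: "openin (mtop M) U" and X: "vector_field_on M U X" "related U X X'"
  shows "vector_field_on N (\<phi> ` U) X'"
proof (rule vector_field_onI)
  note UM = openin_subset[OF U]
  show "X' y \<in> tangent_space N y" if y: "y \<in> \<phi> ` U" for y
  proof -
    obtain x where "x \<in> U" "y = \<phi> x"
      using y by blast
    then show ?thesis
      using X(2) differential_tangent[OF _ vector_field_on_tangent[OF X(1)]] UM
      by (auto simp: related_def)
  qed
  fix d assume d: "d \<in> atlas N"
  show "smooth_on (snd d ` (\<phi> ` U \<inter> fst d)) (\<lambda>u. X' (chart_inv d u) d)"
    using vector_field_on_smooth[OF X(1) pullback_chart_in_atlas[OF d]]
    by (intro smooth_on_cong[OF chart_image_open[OF N d openin_image[OF U]]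
          related_field_component[OF UM X d]]) (simp_all add: pb_image[OF UM])
qed

lemma related_fun_component:
  assumes U: "U \<subseteq> points M" and f: "\<And>x. x \<in> U \<Longrightarrow> f' (\<phi> x) = f x"
    and d: "d \<in> atlas N" and u: "u \<in> snd d ` (\<phi> ` U \<inter> fst d)"
  shows "(f \<circ> chart_inv (pb d)) u = (f' \<circ> chart_inv d) u"
proof -
  obtain x where x: "x \<in> U" "\<phi> x \<in> fst d" "u = snd d (\<phi> x)"
    using u by blast
  then show ?thesis
    using U \<psi>_\<phi>[of x] f[of x] by (auto simp: chart_inv_chart[OF N d] chart_inv_pb[OF d])
qed

lemma related_smooth_fun:
  assumes U: "openin (mtop M) U" and f: "smooth_fun_on M U f" "\<And>x. x \<in> U \<Longrightarrow> f' (\<phi> x) = f x"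
  shows "smooth_fun_on N (\<phi> ` U) f'"
  unfolding smooth_fun_on_def
proof
  note UM = openin_subset[OF U]
  fix d assume d: "d \<in> atlas N"
  have smooth: "smooth_on (snd d ` (\<phi> ` U \<inter> fst d)) (f \<circ> chart_inv (pb d))"
    using smooth_fun_on_smooth[OF f(1) pullback_chart_in_atlas[OF d]] pb_image[OF UM] by simp
  show "smooth_on (snd d ` (\<phi> ` U \<inter> fst d)) (f' \<circ> chart_inv d)"
    by (rule smooth_on_cong[OF chart_image_open[OF N d openin_image[OF U]]
          related_fun_component[where f = f and f' = f', OF UM f(2) d] smooth])
qed

lemma related_dir_deriv:
  assumes U: "openin (mtop M) U" and f: "smooth_fun_on M U f" "\<And>x. x \<in> U \<Longrightarrow> f' (\<phi> x) = f x"
    and x: "x \<in> U" and v: "v \<in> tangent_space M x"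
  shows "dir_deriv N (\<phi> x) (differential M N \<phi> x v) f' = dir_deriv M x v f"
proof -
  note UM = openin_subset[OF U]
  have xM: "x \<in> points M"
    using x UM by blast
  obtain d where d: "d \<in> charts_at N (\<phi> x)"
    using charts_at_nonempty[OF N \<phi>_points[OF xM]] by blast
  then have dN: "d \<in> atlas N" "\<phi> x \<in> fst d"
    by (simp_all add: charts_at_def)
  have "frechet_derivative (f \<circ> chart_inv (pb d)) (at (snd d (\<phi> x)))
      = frechet_derivative (f' \<circ> chart_inv d) (at (snd d (\<phi> x)))"
    using x dN(2)
    by (intro frechet_derivative_cong_open[OF chart_image_open[OF N dN(1) openin_image[OF U]] _
          related_fun_component[where f = f and f' = f', OF UM f(2) dN(1)]]) auto
  then show ?thesis
    using dir_deriv_chart[OF N openin_image[OF U] related_smooth_fun[OF U f] imageI[OF x]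
        differential_tangent[OF xM v] d]
      dir_deriv_chart[OF M U f(1) x v pb_charts_at[OF xM d]] d
    by (simp add: differential_component[OF xM v] pb_at)
qed

text \<open>Since the components agree in corresponding charts, so do the brackets formed from them.\<close>

lemma related_lie_bracket:
  assumes U: "openin (mtop M) U" and x: "x \<in> U"
    and X: "vector_field_on M U X" "related U X X'" and Y: "vector_field_on M U Y" "related U Y Y'"
    and d: "d \<in> charts_at N (\<phi> x)"
  shows "lie_bracket N X' Y' (\<phi> x) d = lie_bracket M X Y x (pb d)"
proof -
  note UM = openin_subset[OF U]
  have xM: "x \<in> points M"
    using x UM by blast
  have dN: "d \<in> atlas N" "\<phi> x \<in> fst d"
    using d by (simp_all add: charts_at_def)
  have deriv: "frechet_derivative (\<lambda>u. Z (chart_inv (pb d) u) (pb d)) (at (snd d (\<phi> x)))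
      = frechet_derivative (\<lambda>u. Z' (chart_inv d u) d) (at (snd d (\<phi> x)))"
    if "vector_field_on M U Z" "related U Z Z'" for Z Z'
    using x dN(2)
    by (intro frechet_derivative_cong_open[OF chart_image_open[OF N dN(1) openin_image[OF U]] _
          related_field_component[OF UM that dN(1)]]) auto
  have comp: "Z' (\<phi> x) d = Z x (pb d)" if "vector_field_on M U Z" "related U Z Z'" for Z Z'
    using that x d differential_component[OF xM vector_field_on_tangent[OF that(1) x], of d]
    by (simp add: related_def)
  show ?thesis
    using d pb_charts_at[OF xM d]
    by (simp add: lie_bracket_def pb_at deriv[OF X] deriv[OF Y] comp[OF X] comp[OF Y])
qed

end

section \<open>Naturality of the Levi-Civita connection\<close>

lemma levi_civita_linear_connection: "levi_civita M g D \<Longrightarrow> linear_connection M D"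
  unfolding levi_civita_def by blast

lemma connection_vector_field:
  "linear_connection M D \<Longrightarrow> openin (mtop M) U \<Longrightarrow> vector_field_on M U X \<Longrightarrow> vector_field_on M U Y \<Longrightarrow>
    vector_field_on M U (\<lambda>x. D x (X x) Y)"
  unfolding linear_connection_def by simp

lemma connection_lin_on:
  "linear_connection M D \<Longrightarrow> openin (mtop M) U \<Longrightarrow> vector_field_on M U Y \<Longrightarrow> x \<in> U \<Longrightarrow>
    lin_on (tangent_space M x) (\<lambda>v. D x v Y)"
  unfolding linear_connection_def by simp

lemma connection_leibniz:
  "linear_connection M D \<Longrightarrow> openin (mtop M) U \<Longrightarrow> smooth_fun_on M U f \<Longrightarrow> vector_field_on M U Y \<Longrightarrow>
    x \<in> U \<Longrightarrow> v \<in> tangent_space M x \<Longrightarrow>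
    D x v (\<lambda>y. f y *\<^sub>R Y y) = dir_deriv M x v f *\<^sub>R Y x + f x *\<^sub>R D x v Y"
  unfolding linear_connection_def by simp

lemma connection_cong:
  assumes "linear_connection M D" "openin (mtop M) U" "vector_field_on M U Y" "\<And>x. x \<in> U \<Longrightarrow> Y x = Z x"
    and "x \<in> U" "v \<in> tangent_space M x"
  shows "D x v Y = D x v Z"
proof -
  have "\<forall>Y Z. vector_field_on M U Y \<and> (\<forall>x\<in>U. Y x = Z x) \<longrightarrow>
          (\<forall>x\<in>U. \<forall>v\<in>tangent_space M x. D x v Y = D x v Z)"
    using assms(1,2) unfolding linear_connection_def by simp
  from this[rule_format, of Y Z x v] show ?thesis
    using assms(3-) by blast
qed

lemma connection_uminus:
  assumes "linear_connection M D" "openin (mtop M) U" "vector_field_on M U Y" "x \<in> U"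
    and "v \<in> tangent_space M x"
  shows "D x v (\<lambda>y. - Y y) = - D x v Y"
  using connection_leibniz[OF assms(1,2) smooth_fun_on_const[of M U "-1"] assms(3-5)]
  by (simp add: dir_deriv_const)

lemma connection_torsion_free:
  "levi_civita M g D \<Longrightarrow> openin (mtop M) U \<Longrightarrow> vector_field_on M U X \<Longrightarrow> vector_field_on M U Y \<Longrightarrow> x \<in> U \<Longrightarrow>
    D x (X x) Y - D x (Y x) X = lie_bracket M X Y x"
  unfolding levi_civita_def torsion_free_def by simp

lemma connection_metric:
  "levi_civita M g D \<Longrightarrow> openin (mtop M) U \<Longrightarrow> vector_field_on M U Y \<Longrightarrow> vector_field_on M U Z \<Longrightarrow> x \<in> U \<Longrightarrow>
    v \<in> tangent_space M x \<Longrightarrow>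
    dir_deriv M x v (\<lambda>y. g y (Y y) (Z y)) = g x (D x v Y) (Z x) + g x (Y x) (D x v Z)"
  unfolding levi_civita_def metric_connection_def by simp

text \<open>The axioms give tangency of \<open>D x v Y\<close> only when \<open>v\<close> is the value of a vector field.\<close>

lemma connection_tangent:
  assumes g: "pseudo_riemannian M g" and D: "linear_connection M D"
    and E: "local_orthonormal_frame M g V E" and x: "x \<in> V" "x \<in> U"
    and U: "openin (mtop M) U" and Y: "vector_field_on M U Y" and v: "v \<in> tangent_space M x"
  shows "D x v Y \<in> tangent_space M x"
proof -
  obtain X where X: "vector_field_on M V X" "X x = v"
    using tangent_vector_extends[OF g E x(1) v] .
  have "vector_field_on M (U \<inter> V) (\<lambda>x. D x (X x) Y)"
    using openin_Int[OF U frame_openin[OF E]] vector_field_on_subset[OF X(1)] vector_field_on_subset[OF Y]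
    by (intro connection_vector_field[OF D]) simp_all
  then show ?thesis
    using vector_field_on_tangent[of M "U \<inter> V" _ x] x X(2) by fastforce
qed

locale anti_isometric = diffeo_pair M N \<phi> \<psi>
  for M :: "('a, 'n::finite) manifold" and N :: "('b, 'n) manifold"
    and \<phi> :: "'a \<Rightarrow> 'b" and \<psi> :: "'b \<Rightarrow> 'a" +
  fixes g :: "('a, 'n) metric" and h :: "('b, 'n) metric"
    and D :: "('a, 'n) connection" and D' :: "('b, 'n) connection"
  assumes g: "pseudo_riemannian M g" and h: "pseudo_riemannian N h"
    and D: "levi_civita M g D" and D': "levi_civita N h D'"
    and anti: "\<And>x v w. x \<in> points M \<Longrightarrow> v \<in> tangent_space M x \<Longrightarrow> w \<in> tangent_space M x \<Longrightarrow>
      h (\<phi> x) (differential M N \<phi> x v) (differential M N \<phi> x w) = - g x v w"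
begin

lemma anti_isometric_inverse: "anti_isometric N M \<psi> \<phi> h g D' D"
proof -
  interpret inv: diffeo_pair N M \<psi> \<phi>
    by (rule diffeo_pair_inverse)
  show ?thesis
  proof (unfold_locales, fact h, fact g, fact D', fact D)
    fix y v w assume y: "y \<in> points N" and vw: "v \<in> tangent_space N y" "w \<in> tangent_space N y"
    have "differential N M \<psi> y v \<in> tangent_space M (\<psi> y)" "differential N M \<psi> y w \<in> tangent_space M (\<psi> y)"
      using inv.differential_tangent[OF y] vw by blast+
    from anti[OF \<psi>_points[OF y] this]
    show "g (\<psi> y) (differential N M \<psi> y v) (differential N M \<psi> y w) = - h y v w"
      using inv.differential_inverse[OF y vw(1)] inv.differential_inverse[OF y vw(2)]
      by (simp add: \<phi>_\<psi>[OF y])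
  qed
qed

abbreviation push :: "('a \<Rightarrow> ('a, 'n) tvec) \<Rightarrow> 'b \<Rightarrow> ('b, 'n) tvec"
  where "push X y \<equiv> differential M N \<phi> (\<psi> y) (X (\<psi> y))"

lemma related_push: "U \<subseteq> points M \<Longrightarrow> related U X (push X)"
  unfolding related_def using \<psi>_\<phi> by (simp add: subset_iff)

text \<open>The difference \<open>\<delta> X Y\<close> of the two connections vanishes by the argument that proves uniqueness
  of the Levi-Civita connection: the form \<open>h (\<delta> X Y) Z\<close> is symmetric in \<open>X, Y\<close>, as neither connection
  has torsion and the brackets correspond, and skew in \<open>Y, Z\<close>, as both are metric. The change of sign of the metric is harmless
  because it multiplies both sides of the metric condition.\<close>

lemma levi_civita_natural:
  assumes E: "local_orthonormal_frame M g V E" and x: "x \<in> V" "x \<in> U"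
    and U: "openin (mtop M) U" and Y: "vector_field_on M U Y" "related U Y Y'"
    and v: "v \<in> tangent_space M x"
  shows "D' (\<phi> x) (differential M N \<phi> x v) Y' = differential M N \<phi> x (D x v Y)"
proof -
  note lcD = levi_civita_linear_connection[OF D] and lcD' = levi_civita_linear_connection[OF D']
  define W where "W = U \<inter> V"
  have W: "openin (mtop M) W" and xW: "x \<in> W"
    using openin_Int[OF U frame_openin[OF E]] x by (simp_all add: W_def)
  have WM: "W \<subseteq> points M" and xM: "x \<in> points M"
    using openin_subset[OF W] xW by blast+
  have yN: "\<phi> x \<in> points N" and y\<phi>W: "\<phi> x \<in> \<phi> ` W"
    using \<phi>_points[OF xM] xW by blast+
  note \<phi>W = openin_image[OF W]
  have ext: "\<exists>X. vector_field_on M W X \<and> X x = w" if "w \<in> tangent_space M x" for w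
    using tangent_vector_extends[OF g E x(1) that] vector_field_on_subset[of M V _ W]
    unfolding W_def by (metis Int_lower2)
  define d where "d = differential M N \<phi> x"
  have dT: "d w \<in> tangent_space N (\<phi> x)" if "w \<in> tangent_space M x" for w
    unfolding d_def by (rule differential_tangent[OF xM that])
  have dlin: "lin_on (tangent_space M x) d"
    unfolding d_def by (rule lin_on_differential[OF xM])
  have push_x: "push X (\<phi> x) = d (X x)" for X
    by (simp add: \<psi>_\<phi>[OF xM] d_def)
  have pushW: "vector_field_on N (\<phi> ` W) (push X)" if "vector_field_on M W X" for X
    by (rule related_vector_field[OF W that related_push[OF WM]])
  define \<delta> where "\<delta> X Y = D' (\<phi> x) (push X (\<phi> x)) (push Y) - d (D x (X x) Y)" for X Y
  have DT: "D x (X x) Z \<in> tangent_space M x"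
    and D'T: "D' (\<phi> x) (push X (\<phi> x)) (push Z) \<in> tangent_space N (\<phi> x)"
    if "vector_field_on M W X" "vector_field_on M W Z" for X Z
    using vector_field_on_tangent[OF connection_vector_field[OF lcD W that] xW]
      vector_field_on_tangent[OF connection_vector_field[OF lcD' \<phi>W pushW[OF that(1)] pushW[OF that(2)]] y\<phi>W]
    by simp_all
  have \<delta>T: "\<delta> X Z \<in> tangent_space N (\<phi> x)" if "vector_field_on M W X" "vector_field_on M W Z" for X Z
    unfolding \<delta>_def by (intro subspace_diff[OF subspace_tangent_space[OF N]] D'T dT DT that)
  have \<delta>_sym: "\<delta> X Z = \<delta> Z X" if X: "vector_field_on M W X" and Z: "vector_field_on M W Z" for X Z
  proof -
    have lieM: "D x (X x) Z - D x (Z x) X = lie_bracket M X Z x"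
      by (rule connection_torsion_free[OF D W X Z xW])
    have lieN: "D' (\<phi> x) (push X (\<phi> x)) (push Z) - D' (\<phi> x) (push Z (\<phi> x)) (push X)
        = lie_bracket N (push X) (push Z) (\<phi> x)"
      by (rule connection_torsion_free[OF D' \<phi>W pushW[OF X] pushW[OF Z] y\<phi>W])
    have LM: "lie_bracket M X Z x \<in> tangent_space M x"
      unfolding lieM[symmetric] by (intro subspace_diff[OF subspace_tangent_space[OF M]] DT X Z)
    have LN: "lie_bracket N (push X) (push Z) (\<phi> x) \<in> tangent_space N (\<phi> x)"
      unfolding lieN[symmetric] by (intro subspace_diff[OF subspace_tangent_space[OF N]] D'T X Z)
    obtain e where e: "e \<in> charts_at N (\<phi> x)"
      using charts_at_nonempty[OF N yN] by blast
    have "lie_bracket N (push X) (push Z) (\<phi> x) e = d (lie_bracket M X Z x) e"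
      using related_lie_bracket[OF W xW X related_push[OF WM] Z related_push[OF WM] e]
        differential_component[OF xM LM, of e] e by (simp add: d_def)
    then have "lie_bracket N (push X) (push Z) (\<phi> x) = d (lie_bracket M X Z x)"
      by (rule tangent_eqI[OF LN dT[OF LM] e])
    then have "D' (\<phi> x) (push X (\<phi> x)) (push Z) - D' (\<phi> x) (push Z (\<phi> x)) (push X)
        = d (D x (X x) Z) - d (D x (Z x) X)"
      by (simp only: lieN flip: lieM lin_on_diff[OF dlin DT[OF X Z] DT[OF Z X]])
    then show ?thesis
      by (simp add: \<delta>_def algebra_simps)
  qed
  have \<delta>_skew: "h (\<phi> x) (\<delta> X Z1) (d (Z2 x)) = - h (\<phi> x) (\<delta> X Z2) (d (Z1 x))"
    if X: "vector_field_on M W X" and Z: "vector_field_on M W Z1" "vector_field_on M W Z2" for X Z1 Z2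
  proof -
    have XT: "X x \<in> tangent_space M x" and ZT: "Z1 x \<in> tangent_space M x" "Z2 x \<in> tangent_space M x"
      by (rule vector_field_on_tangent[OF X xW] vector_field_on_tangent[OF Z(1) xW]
          vector_field_on_tangent[OF Z(2) xW])+
    let ?a = "\<lambda>y. - g y (Z1 y) (Z2 y)" and ?b = "\<lambda>y. h y (push Z1 y) (push Z2 y)"
    have ga: "smooth_fun_on M W (\<lambda>y. g y (Z1 y) (Z2 y))"
      by (rule metric_smooth[OF g W Z])
    then have a: "smooth_fun_on M W ?a"
      using smooth_fun_on_mult[OF M W smooth_fun_on_const[of M W "-1"] ga] by simp
    have ab: "?b (\<phi> y) = ?a y" if y: "y \<in> W" for y
    proof -
      have yM: "y \<in> points M"
        using y WM by blast
      show ?thesis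
        using anti[OF yM vector_field_on_tangent[OF Z(1) y] vector_field_on_tangent[OF Z(2) y]]
        by (simp add: \<psi>_\<phi>[OF yM])
    qed
    have "dir_deriv N (\<phi> x) (push X (\<phi> x)) ?b = dir_deriv M x (X x) ?a"
      unfolding push_x d_def by (rule related_dir_deriv[OF W a ab xW XT])
    also have "\<dots> = - (g x (D x (X x) Z1) (Z2 x) + g x (Z1 x) (D x (X x) Z2))"
      using dir_deriv_uminus[OF M W ga xW XT] connection_metric[OF D W Z xW XT] by simp
    also have "\<dots> = h (\<phi> x) (d (D x (X x) Z1)) (d (Z2 x)) + h (\<phi> x) (d (D x (X x) Z2)) (d (Z1 x))"
      using anti[OF xM DT[OF X Z(1)] ZT(2)] anti[OF xM DT[OF X Z(2)] ZT(1)]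
        metric_sym[OF g xM ZT(1) DT[OF X Z(2)]] by (simp add: d_def)
    finally have 1: "dir_deriv N (\<phi> x) (push X (\<phi> x)) ?b
      = h (\<phi> x) (d (D x (X x) Z1)) (d (Z2 x)) + h (\<phi> x) (d (D x (X x) Z2)) (d (Z1 x))" .
    have "dir_deriv N (\<phi> x) (push X (\<phi> x)) ?b
      = h (\<phi> x) (D' (\<phi> x) (push X (\<phi> x)) (push Z1)) (d (Z2 x))
        + h (\<phi> x) (D' (\<phi> x) (push X (\<phi> x)) (push Z2)) (d (Z1 x))"
      using connection_metric[OF D' \<phi>W pushW[OF Z(1)] pushW[OF Z(2)] y\<phi>W, of "push X (\<phi> x)"]
        metric_sym[OF h yN dT[OF ZT(1)] D'T[OF X Z(2)]] dT[OF XT]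
      by (simp only: push_x)
    with 1 show ?thesis
      unfolding \<delta>_def
      by (simp add: lin_on_diff[OF lin_on_metric_left[OF h yN dT[OF ZT(2)]] D'T[OF X Z(1)] dT[OF DT[OF X Z(1)]]]
          lin_on_diff[OF lin_on_metric_left[OF h yN dT[OF ZT(1)]] D'T[OF X Z(2)] dT[OF DT[OF X Z(2)]]])
  qed
  have YW: "vector_field_on M W Y"
    using vector_field_on_subset[OF Y(1)] by (simp add: W_def)
  obtain X where X: "vector_field_on M W X" "X x = v"
    using ext[OF v] by blast
  have "\<delta> X Y = 0"
  proof (rule metric_nondegenerate[OF h yN \<delta>T[OF X(1) YW]])
    fix w assume w: "w \<in> tangent_space N (\<phi> x)"
    interpret inv: diffeo_pair N M \<psi> \<phi>
      by (rule diffeo_pair_inverse)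
    have "differential N M \<psi> (\<phi> x) w \<in> tangent_space M x"
      using inv.differential_tangent[OF yN w] by (simp add: \<psi>_\<phi>[OF xM])
    then obtain Z where Z: "vector_field_on M W Z" "Z x = differential N M \<psi> (\<phi> x) w"
      using ext by blast
    have dZ: "d (Z x) = w"
      using inv.differential_inverse[OF yN w] by (simp add: Z(2) d_def \<psi>_\<phi>[OF xM])
    have "h (\<phi> x) (\<delta> X Y) (d (Z x)) = - h (\<phi> x) (\<delta> Z X) (d (Y x))"
      by (simp only: \<delta>_skew[OF X(1) YW Z(1)] \<delta>_sym[OF X(1) Z(1)])
    also have "\<dots> = h (\<phi> x) (\<delta> Y Z) (d (X x))"
      by (simp only: \<delta>_skew[OF Z(1) X(1) YW] \<delta>_sym[OF Z(1) YW] minus_minus)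
    also have "\<dots> = - h (\<phi> x) (\<delta> X Y) (d (Z x))"
      by (simp only: \<delta>_skew[OF YW Z(1) X(1)] \<delta>_sym[OF YW X(1)])
    finally show "h (\<phi> x) (\<delta> X Y) w = 0"
      by (simp add: dZ)
  qed
  then have "D' (\<phi> x) (d v) (push Y) = d (D x v Y)"
    by (simp add: \<delta>_def push_x X(2))
  moreover have "D' (\<phi> x) (d v) (push Y) = D' (\<phi> x) (d v) Y'"
  proof (rule connection_cong[OF lcD' \<phi>W pushW[OF YW] _ y\<phi>W dT[OF v]])
    fix y assume "y \<in> \<phi> ` W"
    then obtain z where "z \<in> W" "y = \<phi> z"
      by blast
    then show "push Y y = Y' y"
      using Y(2) WM \<psi>_\<phi>[of z] by (auto simp: related_def W_def)
  qed
  ultimately show ?thesis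
    by (simp add: d_def)
qed

end

section \<open>The tension field\<close>

lemma second_cov_deriv_tangent:
  assumes g: "pseudo_riemannian M g" and D: "linear_connection M D"
    and E: "local_orthonormal_frame M g U E" and x: "x \<in> U" and \<sigma>: "vector_field_on M U \<sigma>"
  shows "second_cov_deriv D (E i) (E i) \<sigma> x \<in> tangent_space M x"
proof -
  note U = frame_openin[OF E] and Ei = frame_vector_field[OF E]
  have "vector_field_on M U (\<lambda>y. D y (E i y) \<sigma>)"
    by (rule connection_vector_field[OF D U Ei \<sigma>])
  then show ?thesis
    unfolding second_cov_deriv_def
    by (intro subspace_diff[OF subspace_tangent_space[OF pseudo_riemannian_smooth_manifold[OF g]]]
        connection_tangent[OF g D E x x U] Ei \<sigma> vector_field_on_tangent[OF Ei x])
qed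

lemma smooth_fun_on_half_square:
  assumes g: "pseudo_riemannian M g" and U: "openin (mtop M) U" and \<sigma>: "vector_field_on M U \<sigma>"
  shows "smooth_fun_on M U (\<lambda>y. g y (\<sigma> y) (\<sigma> y) / 2)"
  using smooth_fun_on_mult[OF pseudo_riemannian_smooth_manifold[OF g] U
      smooth_fun_on_const[of M U "1/2"] metric_smooth[OF g U \<sigma> \<sigma>]] by simp

lemma rough_laplacian_tangent:
  assumes "pseudo_riemannian M g" "linear_connection M D" "local_orthonormal_frame M g U E"
    and "x \<in> U" "vector_field_on M U \<sigma>"
  shows "rough_laplacian g D E \<sigma> x \<in> tangent_space M x"
proof -
  note T = subspace_tangent_space[OF pseudo_riemannian_smooth_manifold[OF assms(1)]]
  show ?thesis
    unfolding rough_laplacian_def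
    by (intro subspace_neg[OF T] subspace_sum[OF T] subspace_scale[OF T] second_cov_deriv_tangent[OF assms])
qed

lemma tension_tangent:
  assumes g: "pseudo_riemannian M g" and D: "linear_connection M D"
    and E: "local_orthonormal_frame M g U E" and x: "x \<in> U" and \<sigma>: "vector_field_on M U \<sigma>"
  shows "tension M g D E p q \<sigma> x \<in> tangent_space M x"
proof -
  note M = pseudo_riemannian_smooth_manifold[OF g] and U = frame_openin[OF E]
  note T = subspace_tangent_space[OF M]
  define F where "F = (\<lambda>y. g y (\<sigma> y) (\<sigma> y) / 2)"
  have "smooth_fun_on M U F"
    unfolding F_def by (rule smooth_fun_on_half_square[OF g U \<sigma>])
  then have "grad M g F x \<in> tangent_space M x"
    by (rule vector_field_on_tangent[OF vector_field_on_grad[OF g E] x])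
  then have "D x (grad M g F x) \<sigma> \<in> tangent_space M x"
    by (rule connection_tangent[OF g D E x x U \<sigma>])
  then show ?thesis
    unfolding tension_def Let_def F_def[symmetric]
    by (intro subspace_diff[OF T] subspace_add[OF T] subspace_scale[OF T]
        rough_laplacian_tangent[OF assms] vector_field_on_tangent[OF \<sigma> x])
qed

context anti_isometric
begin

text \<open>The functions correspond while the metrics differ by a sign, so the gradient changes its sign.\<close>

lemma related_grad:
  assumes E: "local_orthonormal_frame M g U E"
    and f: "smooth_fun_on M U f" "\<And>x. x \<in> U \<Longrightarrow> f' (\<phi> x) = f x"
  shows "related U (\<lambda>x. - grad M g f x) (grad N h f')"
  unfolding related_def
proof
  fix x assume x: "x \<in> U"
  interpret inv: diffeo_pair N M \<psi> \<phi>
    by (rule diffeo_pair_inverse)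
  note U = frame_openin[OF E]
  have xM: "x \<in> points M"
    using x openin_subset[OF U] by blast
  note yN = \<phi>_points[OF xM]
  have G: "grad M g f x \<in> tangent_space M x"
    by (rule vector_field_on_tangent[OF vector_field_on_grad[OF g E f(1)] x])
  then have mG: "- grad M g f x \<in> tangent_space M x"
    by (rule subspace_neg[OF subspace_tangent_space[OF M]])
  show "grad N h f' (\<phi> x) = differential M N \<phi> x (- grad M g f x)"
  proof (rule grad_eqI[OF h yN differential_tangent[OF xM mG]])
    fix w assume w: "w \<in> tangent_space N (\<phi> x)"
    define v where "v = differential N M \<psi> (\<phi> x) w"
    have v: "v \<in> tangent_space M x"
      using inv.differential_tangent[OF yN w] by (simp add: v_def \<psi>_\<phi>[OF xM])
    have wv: "w = differential M N \<phi> x v"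
      using inv.differential_inverse[OF yN w] by (simp add: v_def \<psi>_\<phi>[OF xM])
    have "h (\<phi> x) (differential M N \<phi> x (- grad M g f x)) w = g x (grad M g f x) v"
      unfolding wv anti[OF xM mG v] by (simp add: lin_on_uminus[OF lin_on_metric_left[OF g xM v] G])
    also have "\<dots> = dir_deriv N (\<phi> x) w f'"
      unfolding wv using grad_frame(2)[OF g E f(1) x v] related_dir_deriv[OF U f x v] by simp
    finally show "h (\<phi> x) (differential M N \<phi> x (- grad M g f x)) w = dir_deriv N (\<phi> x) w f'" .
  qed
qed

lemma related_frame:
  assumes E: "local_orthonormal_frame M g U E" and E': "\<And>i. related U (E i) (E' i)"
  shows "local_orthonormal_frame N h (\<phi> ` U) E'"
  unfolding local_orthonormal_frame_def
proof (intro conjI allI ballI)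
  show "openin (mtop N) (\<phi> ` U)"
    by (rule openin_image[OF frame_openin[OF E]])
  show "vector_field_on N (\<phi> ` U) (E' i)" for i
    by (rule related_vector_field[OF frame_openin[OF E] frame_vector_field[OF E] E'])
  fix y i j assume "y \<in> \<phi> ` U"
  then obtain x where x: "x \<in> U" "y = \<phi> x"
    by blast
  have xM: "x \<in> points M"
    using x openin_subset[OF frame_openin[OF E]] by blast
  have "h y (E' i y) (E' j y) = - g x (E i x) (E j x)"
    using anti[OF xM vector_field_on_tangent[OF frame_vector_field[OF E] x(1)]
        vector_field_on_tangent[OF frame_vector_field[OF E] x(1)], of i j] E' x
    by (simp add: related_def)
  moreover have "if i = j then g x (E i x) (E j x) \<in> {1, -1} else g x (E i x) (E j x) = 0"
    using E x(1) unfolding local_orthonormal_frame_def by blast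
  ultimately show "if i = j then h y (E' i y) (E' j y) \<in> {1, -1} else h y (E' i y) (E' j y) = 0"
    by (cases "i = j") auto
qed

end

lemma para_kaehler_facts:
  assumes "para_kaehler M g D J"
  shows "\<And>x. x \<in> points M \<Longrightarrow> lin_on (tangent_space M x) (J x)"
    and "\<And>x v. x \<in> points M \<Longrightarrow> v \<in> tangent_space M x \<Longrightarrow> J x v \<in> tangent_space M x"
    and "\<And>x v. x \<in> points M \<Longrightarrow> v \<in> tangent_space M x \<Longrightarrow> J x (J x v) = v"
    and "\<And>x v w. x \<in> points M \<Longrightarrow> v \<in> tangent_space M x \<Longrightarrow> w \<in> tangent_space M x \<Longrightarrow>
      g x (J x v) w = - g x v (J x w)"
    and "\<And>U X. openin (mtop M) U \<Longrightarrow> vector_field_on M U X \<Longrightarrow> vector_field_on M U (\<lambda>x. J x (X x))"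
    and "\<And>U Y x v. openin (mtop M) U \<Longrightarrow> vector_field_on M U Y \<Longrightarrow> x \<in> U \<Longrightarrow> v \<in> tangent_space M x \<Longrightarrow>
      D x v (\<lambda>y. J y (Y y)) = J x (D x v Y)"
proof -
  have J: "tensor_field_11 M J" and H: "\<forall>x\<in>points M.
        (\<forall>v\<in>tangent_space M x. \<forall>w\<in>tangent_space M x. g x (J x v) w = - g x v (J x w)) \<and>
        (\<forall>v\<in>tangent_space M x. J x (J x v) = v)"
    and P: "\<forall>U Y. openin (mtop M) U \<and> vector_field_on M U Y \<longrightarrow>
        (\<forall>x\<in>U. \<forall>v\<in>tangent_space M x. D x v (\<lambda>y. J y (Y y)) - J x (D x v Y) = 0)"
    using assms unfolding para_kaehler_def almost_para_hermitian_def by simp_all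
  show "\<And>x. x \<in> points M \<Longrightarrow> lin_on (tangent_space M x) (J x)"
    and "\<And>x v. x \<in> points M \<Longrightarrow> v \<in> tangent_space M x \<Longrightarrow> J x v \<in> tangent_space M x"
    and "\<And>U X. openin (mtop M) U \<Longrightarrow> vector_field_on M U X \<Longrightarrow> vector_field_on M U (\<lambda>x. J x (X x))"
    using J unfolding tensor_field_11_def by (simp_all add: image_subset_iff)
  show "\<And>x v. x \<in> points M \<Longrightarrow> v \<in> tangent_space M x \<Longrightarrow> J x (J x v) = v"
    and "\<And>x v w. x \<in> points M \<Longrightarrow> v \<in> tangent_space M x \<Longrightarrow> w \<in> tangent_space M x \<Longrightarrow>
      g x (J x v) w = - g x v (J x w)"
    using H by simp_all
  show "\<And>U Y x v. openin (mtop M) U \<Longrightarrow> vector_field_on M U Y \<Longrightarrow> x \<in> U \<Longrightarrow> v \<in> tangent_space M x \<Longrightarrow>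
      D x v (\<lambda>y. J y (Y y)) = J x (D x v Y)"
    using P by simp
qed

locale para_kaehler_anti_isometric = anti_isometric M N \<phi> \<psi> g h D D'
  for M :: "('a, 'n::finite) manifold" and N :: "('b, 'n) manifold"
    and \<phi> :: "'a \<Rightarrow> 'b" and \<psi> :: "'b \<Rightarrow> 'a"
    and g :: "('a, 'n) metric" and h :: "('b, 'n) metric"
    and D :: "('a, 'n) connection" and D' :: "('b, 'n) connection" +
  fixes J :: "'a \<Rightarrow> ('a, 'n) tvec \<Rightarrow> ('a, 'n) tvec"
  assumes J: "para_kaehler M g D J"
begin

lemmas J_lin_on = para_kaehler_facts(1)[OF J]
  and J_tangent = para_kaehler_facts(2)[OF J]
  and J_J = para_kaehler_facts(3)[OF J]
  and J_skew = para_kaehler_facts(4)[OF J]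
  and J_vector_field = para_kaehler_facts(5)[OF J]
  and J_parallel = para_kaehler_facts(6)[OF J]

text \<open>Two changes of sign cancel in \<open>d\<phi> \<circ> J\<close>: a para-Hermitian \<open>J\<close> satisfies \<open>g (J v) (J w) = - g v w\<close>,
  and \<open>\<phi>\<close> reverses the metric. This map is therefore a genuine isometry of tangent spaces.\<close>

definition d\<phi>J :: "'a \<Rightarrow> ('a, 'n) tvec \<Rightarrow> ('b, 'n) tvec"
  where "d\<phi>J x v = differential M N \<phi> x (J x v)"

lemma lin_on_d\<phi>J: "x \<in> points M \<Longrightarrow> lin_on (tangent_space M x) (d\<phi>J x)"
  unfolding lin_on_def d\<phi>J_def
  using lin_onD[OF J_lin_on] lin_onD[OF lin_on_differential] J_tangent by simp

lemma d\<phi>J_isometric: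
  assumes x: "x \<in> points M" and vw: "v \<in> tangent_space M x" "w \<in> tangent_space M x"
  shows "h (\<phi> x) (d\<phi>J x v) (d\<phi>J x w) = g x v w"
  unfolding d\<phi>J_def
  using anti[OF x J_tangent[OF x vw(1)] J_tangent[OF x vw(2)]] J_skew[OF x vw(1) J_tangent[OF x vw(2)]]
  by (simp add: J_J[OF x vw(2)])

lemma d\<phi>J_eq_zeroD:
  assumes x: "x \<in> points M" and v: "v \<in> tangent_space M x" and "d\<phi>J x v = 0"
  shows "v = 0"
proof (rule metric_nondegenerate[OF g x v])
  fix w assume w: "w \<in> tangent_space M x"
  have "d\<phi>J x w \<in> tangent_space N (\<phi> x)"
    unfolding d\<phi>J_def by (intro differential_tangent J_tangent x w)
  then have "h (\<phi> x) 0 (d\<phi>J x w) = 0"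
    using lin_on_zero[OF lin_on_metric_left[OF h \<phi>_points[OF x]] subspace_tangent_space[OF N]] by blast
  then show "g x v w = 0"
    using d\<phi>J_isometric[OF x v w] assms(3) by simp
qed

text \<open>As \<open>J\<close> is parallel and \<open>d\<phi>\<close> intertwines the connections, \<open>d\<phi> \<circ> J\<close> takes the covariant derivatives of
  \<open>\<sigma>\<close> to those of \<open>\<sigma>'\<close> and preserves \<open>F\<close>. The sign changes with each sum over the frame, with each
  gradient, and with each pairing of vectors that are carried over by \<open>d\<phi>\<close> alone; a pairing of images
  under \<open>d\<phi> \<circ> J\<close> keeps its value. Each term of the tension collects an odd number of such changes.\<close>

lemma tension_related:
  assumes E: "local_orthonormal_frame M g U E" and E': "\<And>i. related U (E i) (E' i)" and x: "x \<in> U"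
    and \<sigma>: "vector_field_on M U \<sigma>" and \<sigma>': "related U (\<lambda>x. J x (\<sigma> x)) \<sigma>'"
  shows "tension N h D' E' p q \<sigma>' (\<phi> x) = - d\<phi>J x (tension M g D E p q \<sigma> x)"
proof -
  note U = frame_openin[OF E]
  have xM: "x \<in> points M" if "x \<in> U" for x
    using that openin_subset[OF U] by blast
  note lcD = levi_civita_linear_connection[OF D]
  note T = subspace_tangent_space[OF M, of x]
  note lin = lin_on_d\<phi>J[OF xM[OF x]]
  have ET: "E i y \<in> tangent_space M y" if "y \<in> U" for i y
    by (rule vector_field_on_tangent[OF frame_vector_field[OF E] that])
  have E'x: "E' i (\<phi> y) = differential M N \<phi> y (E i y)" if "y \<in> U" for i y
    using E' that by (simp add: related_def)
  have \<sigma>T: "\<sigma> y \<in> tangent_space M y" if "y \<in> U" for y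
    by (rule vector_field_on_tangent[OF \<sigma> that])
  have \<sigma>'x: "\<sigma>' (\<phi> y) = d\<phi>J y (\<sigma> y)" if "y \<in> U" for y
    using \<sigma>' that by (simp add: related_def d\<phi>J_def)
  note J\<sigma> = J_vector_field[OF U \<sigma>]
  have D\<sigma>: "D' (\<phi> y) (differential M N \<phi> y v) \<sigma>' = d\<phi>J y (D y v \<sigma>)"
    if "y \<in> U" "v \<in> tangent_space M y" for y v
    using levi_civita_natural[OF E that(1) that(1) U J\<sigma> \<sigma>' that(2)] J_parallel[OF U \<sigma> that]
    by (simp add: d\<phi>J_def)
  have second: "second_cov_deriv D' (E' i) (E' i) \<sigma>' (\<phi> x) = d\<phi>J x (second_cov_deriv D (E i) (E i) \<sigma> x)" for i
  proof -
    let ?Y = "\<lambda>y. D y (E i y) \<sigma>"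
    have Y: "vector_field_on M U ?Y"
      by (rule connection_vector_field[OF lcD U frame_vector_field[OF E] \<sigma>])
    have JY: "related U (\<lambda>y. J y (?Y y)) (\<lambda>y. D' y (E' i y) \<sigma>')"
      using D\<sigma> E'x ET by (simp add: related_def d\<phi>J_def)
    have "D' (\<phi> x) (E' i (\<phi> x)) (\<lambda>y. D' y (E' i y) \<sigma>') = d\<phi>J x (D x (E i x) ?Y)"
      using levi_civita_natural[OF E x x U J_vector_field[OF U Y] JY ET[OF x]]
        J_parallel[OF U Y x ET[OF x]] by (simp add: E'x[OF x] d\<phi>J_def)
    moreover have "D' (\<phi> x) (D' (\<phi> x) (E' i (\<phi> x)) (E' i)) \<sigma>' = d\<phi>J x (D x (D x (E i x) (E i)) \<sigma>)"
      using levi_civita_natural[OF E x x U frame_vector_field[OF E] E' ET[OF x], of i i]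
        D\<sigma>[OF x connection_tangent[OF g lcD E x x U frame_vector_field[OF E] ET[OF x]], of i i]
      by (simp add: E'x[OF x])
    moreover have "D x (E i x) ?Y \<in> tangent_space M x"
      by (rule connection_tangent[OF g lcD E x x U Y ET[OF x]])
    moreover have "D x (D x (E i x) (E i)) \<sigma> \<in> tangent_space M x"
      by (intro connection_tangent[OF g lcD E x x U] \<sigma> frame_vector_field[OF E] ET[OF x])
    ultimately show ?thesis
      by (simp add: second_cov_deriv_def lin_on_diff[OF lin])
  qed
  have sign: "h (\<phi> x) (E' i (\<phi> x)) (E' i (\<phi> x)) = - g x (E i x) (E i x)" for i
    using anti[OF xM[OF x] ET[OF x] ET[OF x]] by (simp add: E'x[OF x])
  have rough: "rough_laplacian h D' E' \<sigma>' (\<phi> x) = - d\<phi>J x (rough_laplacian g D E \<sigma> x)"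
  proof -
    have ST: "second_cov_deriv D (E i) (E i) \<sigma> x \<in> tangent_space M x" for i
      by (rule second_cov_deriv_tangent[OF g lcD E x \<sigma>])
    have "d\<phi>J x (\<Sum>i\<in>UNIV. g x (E i x) (E i x) *\<^sub>R second_cov_deriv D (E i) (E i) \<sigma> x)
        = (\<Sum>i\<in>UNIV. g x (E i x) (E i x) *\<^sub>R d\<phi>J x (second_cov_deriv D (E i) (E i) \<sigma> x))"
      by (rule lin_on_lincomb[OF lin T ST])
    moreover have "(\<Sum>i\<in>UNIV. g x (E i x) (E i x) *\<^sub>R second_cov_deriv D (E i) (E i) \<sigma> x) \<in> tangent_space M x"
      by (intro subspace_sum[OF T] subspace_scale[OF T] ST)
    ultimately show ?thesis
      by (simp add: rough_laplacian_def second sign sum_negf lin_on_uminus[OF lin])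
  qed
  have norm: "nabla_norm h D' E' \<sigma>' (\<phi> x) = - nabla_norm g D E \<sigma> x"
  proof -
    have "D' (\<phi> x) (E' i (\<phi> x)) \<sigma>' = d\<phi>J x (D x (E i x) \<sigma>)" for i
      using D\<sigma>[OF x ET[OF x]] by (simp add: E'x[OF x])
    moreover have "D x (E i x) \<sigma> \<in> tangent_space M x" for i
      by (rule connection_tangent[OF g lcD E x x U \<sigma> ET[OF x]])
    ultimately show ?thesis
      by (simp add: nabla_norm_def sign d\<phi>J_isometric[OF xM[OF x]] sum_negf)
  qed
  define F where "F = (\<lambda>y. g y (\<sigma> y) (\<sigma> y) / 2)"
  define F' where "F' = (\<lambda>y. h y (\<sigma>' y) (\<sigma>' y) / 2)"
  have F: "smooth_fun_on M U F"
    unfolding F_def by (rule smooth_fun_on_half_square[OF g U \<sigma>])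
  have F'x: "F' (\<phi> y) = F y" if "y \<in> U" for y
    using d\<phi>J_isometric[OF xM[OF that] \<sigma>T[OF that] \<sigma>T[OF that]] by (simp add: F_def F'_def \<sigma>'x[OF that])
  define G where "G = grad M g F"
  define G' where "G' = grad N h F'"
  have G: "vector_field_on M U G"
    unfolding G_def by (rule vector_field_on_grad[OF g E F])
  have mG: "vector_field_on M U (\<lambda>y. - G y)"
    using vector_field_on_scaleR[OF M U smooth_fun_on_const[of M U "-1"] G] by simp
  have GG': "related U (\<lambda>y. - G y) G'"
    unfolding G_def G'_def by (rule related_grad[OF E F F'x])
  have GT: "G x \<in> tangent_space M x" "- G x \<in> tangent_space M x"
    using vector_field_on_tangent[OF G x] vector_field_on_tangent[OF mG x] by simp_all
  have G'x: "G' (\<phi> x) = differential M N \<phi> x (- G x)"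
    using GG' x by (simp add: related_def)
  have DGT: "D x (G x) \<sigma> \<in> tangent_space M x"
    by (rule connection_tangent[OF g lcD E x x U \<sigma> GT(1)])
  have along: "D' (\<phi> x) (G' (\<phi> x)) \<sigma>' = - d\<phi>J x (D x (G x) \<sigma>)"
    using D\<sigma>[OF x GT(2)] lin_on_uminus[OF connection_lin_on[OF lcD U \<sigma> x] GT(1)]
    by (simp add: G'x lin_on_uminus[OF lin DGT])
  have square: "h (\<phi> x) (G' (\<phi> x)) (G' (\<phi> x)) = - g x (G x) (G x)"
    using anti[OF xM[OF x] GT(2) GT(2)] lin_on_uminus[OF lin_on_metric[OF g xM[OF x] GT(2)] GT(1)]
      lin_on_uminus[OF lin_on_metric_left[OF g xM[OF x] GT(1)] GT(1)]
    by (simp add: G'x)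
  have lap: "laplacian N h D' E' F' (\<phi> x) = - laplacian M g D E F x"
  proof -
    have "h (\<phi> x) (D' (\<phi> x) (E' i (\<phi> x)) G') (E' i (\<phi> x)) = g x (D x (E i x) G) (E i x)" for i
    proof -
      have DG: "D x (E i x) G \<in> tangent_space M x"
        by (rule connection_tangent[OF g lcD E x x U G ET[OF x]])
      then have mDG: "- D x (E i x) G \<in> tangent_space M x"
        by (rule subspace_neg[OF T])
      have "D' (\<phi> x) (E' i (\<phi> x)) G' = differential M N \<phi> x (- D x (E i x) G)"
        using levi_civita_natural[OF E x x U mG GG' ET[OF x]] connection_uminus[OF lcD U G x ET[OF x]]
        by (simp add: E'x[OF x])
      then show ?thesis
        using anti[OF xM[OF x] mDG ET[OF x], of i]
          lin_on_uminus[OF lin_on_metric_left[OF g xM[OF x] ET[OF x]] DG, of i]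
        by (simp add: E'x[OF x])
    qed
    then show ?thesis
      unfolding laplacian_def divergence_def G_def[symmetric] G'_def[symmetric]
      by (simp add: sign sum_negf)
  qed
  let ?R = "rough_laplacian g D E \<sigma> x"
  define c where "c = p * nabla_norm g D E \<sigma> x - p * q * g x (G x) (G x) - q * (1 + 2 * F x) * laplacian M g D E F x"
  have RT: "?R \<in> tangent_space M x"
    by (rule rough_laplacian_tangent[OF g lcD E x \<sigma>])
  have "tension N h D' E' p q \<sigma>' (\<phi> x)
    = (1 + 2 * F x) *\<^sub>R (- d\<phi>J x ?R) + (2 * p) *\<^sub>R (- d\<phi>J x (D x (G x) \<sigma>)) - (- c) *\<^sub>R d\<phi>J x (\<sigma> x)"
    unfolding tension_def Let_def F'_def[symmetric] G'_def[symmetric]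
    by (simp add: F'x[OF x] rough along norm square lap \<sigma>'x[OF x] c_def algebra_simps)
  also have "\<dots> = - d\<phi>J x ((1 + 2 * F x) *\<^sub>R ?R + (2 * p) *\<^sub>R D x (G x) \<sigma> - c *\<^sub>R \<sigma> x)"
    by (simp add: lin_on_diff[OF lin] lin_on_add[OF lin] lin_on_scaleR[OF lin] RT DGT \<sigma>T[OF x]
        subspace_add[OF T] subspace_scale[OF T])
  also have "\<dots> = - d\<phi>J x (tension M g D E p q \<sigma> x)"
    unfolding tension_def Let_def F_def[symmetric] G_def[symmetric] c_def ..
  finally show ?thesis .
qed

text \<open>Harmonicity is witnessed by a frame around each point, and frames can be transported along \<open>\<phi>\<close> in
  both directions.\<close>

lemma pq_harmonic_iff:
  assumes \<sigma>: "vector_field_on M (points M) \<sigma>" and \<sigma>': "related (points M) (\<lambda>x. J x (\<sigma> x)) \<sigma>'"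
  shows "pq_harmonic N h D' p q \<sigma>' \<longleftrightarrow> pq_harmonic M g D p q \<sigma>"
proof
  interpret inv: anti_isometric N M \<psi> \<phi> h g D' D
    by (rule anti_isometric_inverse)
  assume N_harmonic: "pq_harmonic N h D' p q \<sigma>'"
  show "pq_harmonic M g D p q \<sigma>"
    unfolding pq_harmonic_def
  proof (intro conjI ballI \<sigma>)
    fix x assume x: "x \<in> points M"
    obtain U' E' where U': "\<phi> x \<in> U'" and E': "local_orthonormal_frame N h U' E'"
      and tension: "tension N h D' E' p q \<sigma>' (\<phi> x) = 0"
      using N_harmonic \<phi>_points[OF x] unfolding pq_harmonic_def by blast
    have U'N: "U' \<subseteq> points N"
      by (rule openin_subset[OF frame_openin[OF E']])
    define E where "E i = inv.push (E' i)" for i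
    have "local_orthonormal_frame M g (\<psi> ` U') E"
      unfolding E_def by (rule inv.related_frame[OF E' inv.related_push[OF U'N]])
    moreover have "x \<in> \<psi> ` U'"
      using imageI[OF U', of \<psi>] by (simp add: \<psi>_\<phi>[OF x])
    moreover have "related (\<psi> ` U') (E i) (E' i)" for i
      unfolding related_def
    proof
      fix z assume "z \<in> \<psi> ` U'"
      then obtain y where y: "y \<in> U'" "z = \<psi> y"
        by blast
      then have yN: "y \<in> points N"
        using U'N by blast
      show "E' i (\<phi> z) = differential M N \<phi> z (E i z)"
        using inv.differential_inverse[OF yN vector_field_on_tangent[OF frame_vector_field[OF E'] y(1)]]
        by (simp add: E_def y(2) \<phi>_\<psi>[OF yN])
    qed
    ultimately obtain U where E: "local_orthonormal_frame M g U E" and xU: "x \<in> U"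
      and EE': "\<And>i. related U (E i) (E' i)"
      by blast
    have UM: "U \<subseteq> points M"
      by (rule openin_subset[OF frame_openin[OF E]])
    note \<sigma>U = vector_field_on_subset[OF \<sigma> UM]
    have "related U (\<lambda>x. J x (\<sigma> x)) \<sigma>'"
      using \<sigma>' UM by (auto simp: related_def)
    then have "d\<phi>J x (tension M g D E p q \<sigma> x) = 0"
      using tension_related[OF E EE' xU \<sigma>U] tension by simp
    then have "tension M g D E p q \<sigma> x = 0"
      by (rule d\<phi>J_eq_zeroD[OF x tension_tangent[OF g levi_civita_linear_connection[OF D] E xU \<sigma>U]])
    then show "\<exists>U E. x \<in> U \<and> local_orthonormal_frame M g U E \<and> tension M g D E p q \<sigma> x = 0"
      using E xU by blast
  qed
next
  assume M_harmonic: "pq_harmonic M g D p q \<sigma>"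
  show "pq_harmonic N h D' p q \<sigma>'"
    unfolding pq_harmonic_def
  proof (intro conjI ballI)
    show "vector_field_on N (points N) \<sigma>'"
      using related_vector_field[OF openin_topspace J_vector_field[OF openin_topspace \<sigma>] \<sigma>']
      by (simp add: image_points)
    fix y assume y: "y \<in> points N"
    note x = \<psi>_points[OF y]
    obtain U E where U: "\<psi> y \<in> U" and E: "local_orthonormal_frame M g U E"
      and tension: "tension M g D E p q \<sigma> (\<psi> y) = 0"
      using M_harmonic x unfolding pq_harmonic_def by blast
    have UM: "U \<subseteq> points M"
      by (rule openin_subset[OF frame_openin[OF E]])
    have "local_orthonormal_frame N h (\<phi> ` U) (\<lambda>i. push (E i))"
      by (rule related_frame[OF E related_push[OF UM]])
    moreover have "y \<in> \<phi> ` U"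
      using imageI[OF U, of \<phi>] by (simp add: \<phi>_\<psi>[OF y])
    moreover have "tension N h D' (\<lambda>i. push (E i)) p q \<sigma>' y = 0"
      using tension_related[OF E related_push[OF UM] U vector_field_on_subset[OF \<sigma> UM], of \<sigma>' p q]
        \<sigma>' UM lin_on_zero[OF lin_on_d\<phi>J[OF x] subspace_tangent_space[OF M]]
      by (simp add: related_def subset_iff \<phi>_\<psi>[OF y] tension)
    ultimately show "\<exists>U E. y \<in> U \<and> local_orthonormal_frame N h U E \<and> tension N h D' E p q \<sigma>' y = 0"
      by blast
  qed
qed

end

lemma diffeomorphism_imp_diffeo_pair:
  assumes M: "smooth_manifold M" and N: "smooth_manifold N" and \<phi>: "diffeomorphism M N \<phi>"
  shows "diffeo_pair M N \<phi> (inv_into (points M) \<phi>)"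
proof
  have bij: "bij_betw \<phi> (points M) (points N)"
    using \<phi> by (simp add: diffeomorphism_def)
  show "\<phi> x \<in> points N" if "x \<in> points M" for x
    using bij that by (rule bij_betwE[rule_format])
  show "inv_into (points M) \<phi> y \<in> points M" if "y \<in> points N" for y
    using bij that by (simp add: bij_betw_imp_surj_on inv_into_into)
  show "inv_into (points M) \<phi> (\<phi> x) = x" if "x \<in> points M" for x
    using bij that by (simp add: bij_betw_inv_into_left)
  show "\<phi> (inv_into (points M) \<phi> y) = y" if "y \<in> points N" for y
    using bij that by (simp add: bij_betw_inv_into_right)
qed (use assms in \<open>simp_all add: diffeomorphism_def\<close>)

theorem proposition8p1:
  fixes M :: "('a, 'n::finite) manifold" and N :: "('b, 'n) manifold"
    and g :: "('a, 'n) metric" and h :: "('b, 'n) metric"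
    and D :: "('a, 'n) connection" and D' :: "('b, 'n) connection"
    and J :: "'a \<Rightarrow> ('a, 'n) tvec \<Rightarrow> ('a, 'n) tvec"
    and \<phi> :: "'a \<Rightarrow> 'b"
    and \<sigma> :: "'a \<Rightarrow> ('a, 'n) tvec"
  assumes "pseudo_riemannian M g" and "levi_civita M g D"
    and "para_kaehler M g D J"
    and "pseudo_riemannian N h" and "levi_civita N h D'"
    and "anti_isometry M g N h \<phi>"
    and "harmonic_vector_field M g D \<sigma>"
  shows "harmonic_vector_field N h D' (push_forward M N \<phi> (\<lambda>x. J x (\<sigma> x)))
    \<and> metric_parameters N h D' (push_forward M N \<phi> (\<lambda>x. J x (\<sigma> x))) = metric_parameters M g D \<sigma>"
proof -
  interpret diffeo_pair M N \<phi> "inv_into (points M) \<phi>"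
    using assms(6) by (intro diffeomorphism_imp_diffeo_pair pseudo_riemannian_smooth_manifold[OF assms(1)]
        pseudo_riemannian_smooth_manifold[OF assms(4)]) (simp add: anti_isometry_def)
  interpret para_kaehler_anti_isometric M N \<phi> "inv_into (points M) \<phi>" g h D D' J
    using assms(1-6) by unfold_locales (simp_all add: anti_isometry_def)
  have \<sigma>: "vector_field_on M (points M) \<sigma>"
    using assms(7) unfolding harmonic_vector_field_def pq_harmonic_def by blast
  have "related (points M) (\<lambda>x. J x (\<sigma> x)) (push_forward M N \<phi> (\<lambda>x. J x (\<sigma> x)))"
    unfolding related_def push_forward_def Let_def by (simp add: \<psi>_\<phi>)
  then have "pq_harmonic N h D' p q (push_forward M N \<phi> (\<lambda>x. J x (\<sigma> x))) \<longleftrightarrow> pq_harmonic M g D p q \<sigma>"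
    for p q
    by (rule pq_harmonic_iff[OF \<sigma>])
  then show ?thesis
    using assms(7) by (simp add: harmonic_vector_field_def metric_parameters_def)
qed

end
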